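(* Let $\mathbb F$ be algebraically closed of characteristic $0$ and let $(\rho_0,\dots,\rho_d)$ be the shape of a TD pair over $\mathbb F$ that has Krawtchouk type. Then there exist a nonnegative integer $N$ and positive integers $d_1,\dots,d_N$ such that $$\sum_{i=0}^d\rho_i\lambda^i=\prod_{j=1}^N(1+\lambda+\lambda^2+\cdots+\lambda^{d_j}).$$ In particular $\rho_0=1$.
   Context: A TD pair on a finite-dimensional $\mathbb F$-vector space $V$ is an ordered pair $A,A^*$ of diagonalizable linear maps on $V$ such that for some ordering $V_0,\dots,V_d$ of the eigenspaces of $A$ one has $A^*V_i\subseteq V_{i-1}+V_i+V_{i+1}$ ($0\le i\le d$), for some ordering $V^*_0,\dots,V^*_\delta$ of the eigenspaces of $A^*$ one has $AV^*_i\subseteq V^*_{i-1}+V^*_i+V^*_{i+1}$ ($0\le i\le\delta$) (terms with out-of-range index are $0$), and no subspace $W\neq 0,V$ satisfies $AW\subseteq W$, $A^*W\subseteq W$. Such orderings are called standard; an ordering of eigenvalues is standard if the corresponding ordering of eigenspaces is. It is known that $d=\delta$ (the diameter) and $\dim V_i=\dim V^*_i=:\rho_i$; $(\rho_0,\dots,\rho_d)$ is the shape. The TD pair has Krawtchouk type if the sequence $d,d-2,d-4,\dots,-d$ (i.e. $(d-2i)_{i=0}^d$) is a standard ordering of the eigenvalues of $A$ and also a standard ordering of the eigenvalues of $A^*$. *)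

theory Defs
  imports "Jordan_Normal_Form.Jordan_Normal_Form_Uniqueness"
begin

definition alg_closed_field :: "'a::field itself \<Rightarrow> bool" where
  "alg_closed_field _ \<longleftrightarrow> (\<forall>p :: 'a poly. degree p > 0 \<longrightarrow> (\<exists>x. poly p x = 0))"

definition eigspace :: "'a::field mat \<Rightarrow> 'a \<Rightarrow> 'a vec set" where
  "eigspace A \<theta> = mat_kernel (A - \<theta> \<cdot>\<^sub>m 1\<^sub>m (dim_row A))"

definition is_eigenvalue :: "'a::field mat \<Rightarrow> 'a \<Rightarrow> bool" where
  "is_eigenvalue A \<theta> \<longleftrightarrow> (\<exists>v \<in> eigspace A \<theta>. v \<noteq> 0\<^sub>v (dim_row A))"

definition diagonalizable :: "'a::field mat \<Rightarrow> bool" where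
  "diagonalizable A \<longleftrightarrow> (\<exists>D. diagonal_mat D \<and> similar_mat A D)"

definition sub_sum :: "'a::field vec set \<Rightarrow> 'a vec set \<Rightarrow> 'a vec set" where
  "sub_sum U W = {u + w | u w. u \<in> U \<and> w \<in> W}"

definition is_subspace :: "nat \<Rightarrow> 'a::field vec set \<Rightarrow> bool" where
  "is_subspace n W \<longleftrightarrow> W \<subseteq> carrier_vec n \<and> 0\<^sub>v n \<in> W \<and>
     (\<forall>u\<in>W. \<forall>w\<in>W. u + w \<in> W) \<and> (\<forall>c. \<forall>w\<in>W. c \<cdot>\<^sub>v w \<in> W)"

definition eig_at :: "'a::field mat \<Rightarrow> 'a list \<Rightarrow> int \<Rightarrow> 'a vec set" where
  "eig_at A \<theta>s i = (if 0 \<le> i \<and> i < int (length \<theta>s) then eigspace A (\<theta>s ! nat i)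
                     else {0\<^sub>v (dim_row A)})"

definition standard_ordering :: "'a::field mat \<Rightarrow> 'a mat \<Rightarrow> 'a list \<Rightarrow> bool" where
  "standard_ordering A B \<theta>s \<longleftrightarrow> distinct \<theta>s \<and> set \<theta>s = {\<theta>. is_eigenvalue A \<theta>} \<and>
     (\<forall>i < length \<theta>s. \<forall>v \<in> eigspace A (\<theta>s ! i).
        B *\<^sub>v v \<in> sub_sum (sub_sum (eig_at A \<theta>s (int i - 1)) (eig_at A \<theta>s (int i)))
                           (eig_at A \<theta>s (int i + 1)))"

definition TD_pair :: "nat \<Rightarrow> 'a::field mat \<Rightarrow> 'a mat \<Rightarrow> bool" where
  "TD_pair n A As \<longleftrightarrow> A \<in> carrier_mat n n \<and> As \<in> carrier_mat n n \<and>
     diagonalizable A \<and> diagonalizable As \<and>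
     (\<exists>\<theta>s. standard_ordering A As \<theta>s) \<and> (\<exists>\<theta>s. standard_ordering As A \<theta>s) \<and>
     (\<forall>W. is_subspace n W \<and> (\<forall>w\<in>W. A *\<^sub>v w \<in> W) \<and> (\<forall>w\<in>W. As *\<^sub>v w \<in> W)
          \<longrightarrow> W = {0\<^sub>v n} \<or> W = carrier_vec n)"

definition krawtchouk_seq :: "nat \<Rightarrow> 'a::field list" where
  "krawtchouk_seq d = map (\<lambda>i. of_int (int d - 2 * int i)) [0..<Suc d]"

definition krawtchouk_type :: "'a::field mat \<Rightarrow> 'a mat \<Rightarrow> nat \<Rightarrow> bool" where
  "krawtchouk_type A As d \<longleftrightarrow> standard_ordering A As (krawtchouk_seq d) \<and>
                             standard_ordering As A (krawtchouk_seq d)"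

definition shape :: "'a::field mat \<Rightarrow> nat \<Rightarrow> nat list" where
  "shape A d = map (\<lambda>\<theta>. kernel_dim (A - \<theta> \<cdot>\<^sub>m 1\<^sub>m (dim_row A))) (krawtchouk_seq d)"

end

theory Submission
  imports Defs "HOL-Library.Function_Algebras"
begin

text \<open>Splitting \<open>A\<^sup>* = X + Y + Z\<close> into its components of weight \<open>2, -2, 0\<close> under \<open>ad A\<close>, the tridiagonal
  relations become the Dolan--Grady relations. These generate a Lie algebra with basis
  \<open>A, Z, x\<^sub>i, y\<^sub>i, Q\<^sub>i\<close> that looks like \<open>sl\<^sub>2[u]\<close> up to a twist by \<open>u\<^sup>2 - 4\<close>, and \<open>V\<close> is a highest weight
  module for it: a common eigenvector \<open>v\<close> of \<open>Z\<close> and the \<open>Q\<^sub>i\<close> in the top eigenspace of \<open>A\<close> generates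
  \<open>V\<close> under the commuting operators \<open>y\<^sub>i\<close>. Finite dimension forces the ideal of polynomials \<open>q\<close> with
  \<open>Y(q) = 0\<close> to contain a product of distinct linear factors \<open>u - a\<close>, \<open>a \<noteq> 2, -2\<close>. Lagrange
  interpolation at these points splits the action into commuting \<open>sl\<^sub>2\<close>-triples \<open>(e\<^sub>a, f\<^sub>a, h\<^sub>a)\<close>, so the
  monomials in the \<open>f\<^sub>a\<close> with exponents at most \<open>d\<^sub>a\<close>, applied to \<open>v\<close>, are a basis of \<open>V\<close> consisting of
  eigenvectors of \<open>A\<close>. Counting them by total degree gives the product formula.\<close>

section \<open>Commutators and the Dolan--Grady relations\<close>

definition lie :: "'b::ring_1 \<Rightarrow> 'b \<Rightarrow> 'b" where
  "lie a b = a * b - b * a"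

lemma lie_self [simp]: "lie a a = 0"
  by (simp add: lie_def)

lemma lie_zero [simp]: "lie 0 a = 0" "lie a 0 = 0"
  by (simp_all add: lie_def)

lemma lie_swap: "lie a b = - lie b a"
  by (simp add: lie_def)

lemma lie_add [simp]: "lie (a + b) c = lie a c + lie b c" "lie a (b + c) = lie a b + lie a c"
  by (simp_all add: lie_def algebra_simps)

lemma lie_diff [simp]: "lie (a - b) c = lie a c - lie b c" "lie a (b - c) = lie a b - lie a c"
  by (simp_all add: lie_def algebra_simps)

lemma lie_minus [simp]: "lie (- a) c = - lie a c" "lie a (- c) = - lie a c"
  by (simp_all add: lie_def algebra_simps)

lemma lie_scale:
  assumes "\<And>t. c * t = t * c"
  shows "lie (c * a) b = c * lie a b" "lie a (c * b) = c * lie a b"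
  using assms[of a] by (simp_all add: lie_def right_diff_distrib mult.assoc)
    (metis assms mult.assoc)+

lemma numeral_commute: "numeral k * (t :: 'b::ring_1) = t * numeral k"
  by (metis mult_of_int_commute of_int_numeral)

lemma lie_numeral [simp]:
  "lie (numeral k * a) b = numeral k * lie a b" "lie a (numeral k * b) = numeral k * lie a b"
  by (rule lie_scale, rule numeral_commute)+

lemma lie_jacobi: "lie a (lie b c) = lie (lie a b) c + lie b (lie a c)"
  by (simp add: lie_def algebra_simps)

lemma torsion_free_numeral:
  fixes a :: "'b::ring_1"
  assumes "\<And>n (a::'b). of_nat (Suc n) * a = 0 \<Longrightarrow> a = 0" and "numeral k * a = 0"
  shows "a = 0"
  using assms by (metis of_nat_numeral not0_implies_Suc zero_neq_numeral)

lemma weight_components_zero: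
  fixes A :: "'b::ring_1"
  assumes tf: "\<And>n (a::'b). of_nat (Suc n) * a = 0 \<Longrightarrow> a = 0"
    and w: "lie A a = 4 * a" "lie A b = 2 * b" "lie A c = 0" "lie A d = - (2 * d)" "lie A e = - (4 * e)"
    and s0: "a + b + c + d + e = 0"
  shows "a = 0" "b = 0" "c = 0" "d = 0" "e = 0"
proof -
  have tf': "t = 0" if "numeral k * t = 0" for k and t :: 'b
    using torsion_free_numeral tf that by blast
  have s1: "4 * a + 2 * b - 2 * d - 4 * e = 0"
    using arg_cong[OF s0, of "lie A"] w by simp
  have s2: "16 * a + 4 * b + 4 * d + 16 * e = 0"
    using arg_cong[OF s1, of "lie A"] w by (simp add: mult.assoc[symmetric])
  have s3: "64 * a + 8 * b - 8 * d - 64 * e = 0"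
    using arg_cong[OF s2, of "lie A"] w by (simp add: mult.assoc[symmetric])
  have s4: "256 * a + 16 * b + 16 * d + 256 * e = 0"
    using arg_cong[OF s3, of "lie A"] w by (simp add: mult.assoc[symmetric])
  have "384 * a = (256 * a + 16 * b + 16 * d + 256 * e) + 4 * (64 * a + 8 * b - 8 * d - 64 * e)
      - 4 * (16 * a + 4 * b + 4 * d + 16 * e) - 16 * (4 * a + 2 * b - 2 * d - 4 * e)"
    by (simp add: algebra_simps) (simp flip: distrib_right add.assoc)
  then show a: "a = 0" using s1 s2 s3 s4 tf' by simp
  have "384 * e = (256 * a + 16 * b + 16 * d + 256 * e) - 4 * (64 * a + 8 * b - 8 * d - 64 * e)
      - 4 * (16 * a + 4 * b + 4 * d + 16 * e) + 16 * (4 * a + 2 * b - 2 * d - 4 * e)"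
    by (simp add: algebra_simps) (simp flip: distrib_right add.assoc)
  then show e: "e = 0" using s1 s2 s3 s4 tf' by simp
  have "8 * b = (16 * a + 4 * b + 4 * d + 16 * e) + 2 * (4 * a + 2 * b - 2 * d - 4 * e)"
    using a e by (simp add: algebra_simps) (simp flip: distrib_right add.assoc)
  then have "8 * b = 0" using s1 s2 by simp
  then show b: "b = 0" using tf' by blast
  then show d: "d = 0" using s1 a e tf' by simp
  show "c = 0" using s0 a b d e by simp
qed

lemma dolan_grady_weight_components:
  fixes A X Y Z :: "'b::ring_1"
  assumes tf: "\<And>n (a::'b). of_nat (Suc n) * a = 0 \<Longrightarrow> a = 0"
    and AX: "lie A X = 2 * X" and AY: "lie A Y = - (2 * Y)" and AZ: "lie A Z = 0"
    and DG: "lie (X + Y + Z) (lie (X + Y + Z) (lie (X + Y + Z) A)) = 4 * lie (X + Y + Z) A"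
  shows "lie Z (lie X Y) = 0" "lie X (lie Z X) = 0" "lie Y (lie Z Y) = 0"
    "lie Z (lie Z X) = 4 * X + 2 * lie X (lie X Y)"
    "lie Z (lie Z Y) = 4 * Y - 2 * lie Y (lie X Y)"
proof -
  let ?B = "X + Y + Z"
  define P where "P = lie X Y"
  define x1 where "x1 = lie Z X"
  define y1 where "y1 = lie Y Z"
  define c0 where "c0 = lie X y1 + lie Y x1 - 2 * lie Z P"
  define c2 where "c2 = lie Z x1 - 2 * lie X P - 4 * X"
  define c_2 where "c_2 = lie Z y1 - 2 * lie Y P + 4 * Y"
  have AP: "lie A P = 0" and Ax1: "lie A x1 = 2 * x1" and Ay1: "lie A y1 = - (2 * y1)"
    unfolding P_def x1_def y1_def by (subst lie_jacobi, simp add: AX AY AZ)+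
  have two: "2 * (2 * t) = 4 * t" for t :: 'b by (simp add: mult.assoc[symmetric])
  have "lie A (lie X x1) = 4 * lie X x1" "lie A (lie Y y1) = - (4 * lie Y y1)"
    "lie A c0 = 0" "lie A c2 = 2 * c2" "lie A c_2 = - (2 * c_2)"
    unfolding c0_def c2_def c_2_def
    by (simp_all add: lie_jacobi[of A] AX AY AZ AP Ax1 Ay1 algebra_simps)
       (simp_all add: mult.assoc[symmetric] numeral_commute flip: mult_2, simp_all add: mult.assoc)
  note w = this
  have BA: "lie ?B A = 2 * (Y - X)"
    using AX AY AZ by (simp add: lie_swap[of _ A] algebra_simps)
  have BBA: "lie ?B (lie ?B A) = - (2 * (x1 + y1 - 2 * P))"
    unfolding BA by (simp add: x1_def y1_def P_def lie_swap[of Y X] lie_swap[of Z Y] algebra_simps)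
      (simp add: mult.assoc numeral_commute flip: distrib_left)
  have "2 * (lie ?B (x1 + y1 - 2 * P)) = 2 * (4 * (X - Y))"
    using DG unfolding BBA unfolding BA by (simp add: algebra_simps mult.assoc[symmetric])
  then have "2 * (lie ?B (x1 + y1 - 2 * P) - 4 * (X - Y)) = 0"
    by (simp add: right_diff_distrib)
  then have W: "lie ?B (x1 + y1 - 2 * P) - 4 * (X - Y) = 0"
    using torsion_free_numeral tf by blast
  have "lie X x1 + c2 + c0 + c_2 + lie Y y1 = lie ?B (x1 + y1 - 2 * P) - 4 * (X - Y)"
    by (simp add: c0_def c2_def c_2_def algebra_simps)
  also note W
  finally have "lie X x1 + c2 + c0 + c_2 + lie Y y1 = 0" .
  note z = weight_components_zero[OF tf w(1,4,3,5,2) this]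
  show "lie X (lie Z X) = 0" using z(1) by (simp add: x1_def)
  show "lie Y (lie Z Y) = 0" using z(5) by (simp add: y1_def lie_swap[of Y Z])
  show "lie Z (lie Z X) = 4 * X + 2 * lie X (lie X Y)"
    using z(2) by (simp add: c2_def x1_def P_def algebra_simps)
  show "lie Z (lie Z Y) = 4 * Y - 2 * lie Y (lie X Y)"
    using z(4) by (simp add: c_2_def y1_def P_def lie_swap[of Y Z] algebra_simps)
  have "lie Z P = - lie Y x1 - lie X y1"
    by (simp add: P_def lie_jacobi[of Z] x1_def[symmetric])
      (simp add: y1_def lie_swap[of x1 Y] lie_swap[of Y Z])
  then have "- c0 = (1 + 2) * lie Z P" unfolding distrib_right by (simp add: c0_def)
  then have "3 * lie Z P = 0" using z(3) by simp
  then show "lie Z (lie X Y) = 0" unfolding P_def using torsion_free_numeral tf by blast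
qed

text \<open>In the model of the Onsager algebra inside \<open>sl\<^sub>2[u]\<close> where \<open>X\<close>, \<open>Y\<close>, \<open>Z\<close> are \<open>(u\<^sup>2 - 4) e\<close>, \<open>- f / 4\<close>, \<open>u h / 2\<close>, the element \<open>x i\<close> is \<open>u\<^sup>i X\<close>, \<open>y i\<close> is \<open>u\<^sup>i Y\<close>, and \<open>Q i\<close> is \<open>u\<^sup>i (4 - u\<^sup>2) h / 4\<close>.\<close>

locale onsager =
  fixes X Y Z :: "'b::ring_1"
  assumes tf: "of_nat (Suc n) * (a::'b) = 0 \<Longrightarrow> a = 0"
    and ZXY: "lie Z (lie X Y) = 0"
    and XZX: "lie X (lie Z X) = 0"
    and YZY: "lie Y (lie Z Y) = 0"
    and ZZX: "lie Z (lie Z X) = 4 * X + 2 * lie X (lie X Y)"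
    and ZZY: "lie Z (lie Z Y) = 4 * Y - 2 * lie Y (lie X Y)"
begin

definition x :: "nat \<Rightarrow> 'b" where "x i = (lie Z ^^ i) X"
definition y :: "nat \<Rightarrow> 'b" where "y i = (lie (- Z) ^^ i) Y"
definition Q :: "nat \<Rightarrow> 'b" where "Q i = lie (x i) Y"

lemma x_0 [simp]: "x 0 = X" and y_0 [simp]: "y 0 = Y"
  by (simp_all add: x_def y_def)

lemma lie_Z_x: "lie Z (x i) = x (Suc i)" and lie_Z_y: "lie Z (y i) = - y (Suc i)"
  by (simp_all add: x_def y_def)

lemma Q_0: "Q 0 = lie X Y"
  by (simp add: Q_def)

lemma dual: "onsager Y X (- Z)"
proof
  show "of_nat (Suc n) * a = 0 \<Longrightarrow> a = 0" for n and a :: 'b by (rule tf)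
qed (use ZXY XZX YZY ZZX ZZY in \<open>simp_all add: lie_swap[of Y X]\<close>)

lemma two_lie_Q0_x: "2 * lie (Q 0) (x i) = 4 * x i - x (i + 2)"
proof (induction i)
  case 0
  have "x 2 = 4 * X + 2 * lie X (lie X Y)"
    using ZZX by (simp add: numeral_2_eq_2 lie_Z_x[symmetric])
  then show ?case by (simp add: Q_0 lie_swap[of X "lie X Y"] numeral_2_eq_2)
next
  case (Suc i)
  have "2 * lie (Q 0) (x (Suc i)) = 2 * lie Z (lie (Q 0) (x i))"
    using ZXY by (simp add: lie_jacobi[of Z "lie X Y"] Q_0 lie_Z_x)
  also have "\<dots> = lie Z (2 * lie (Q 0) (x i))" by simp
  finally show ?case unfolding Suc by (simp add: lie_Z_x)
qed

lemma two_cancel: "2 * (a::'b) = 0 \<Longrightarrow> a = 0"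
  using tf[of 1 a] by simp

lemma lie_x_x: "lie (x i) (x j) = 0"
proof (induction "i + j" arbitrary: i j rule: less_induct)
  case less
  show ?case
  proof (cases "i + j \<ge> 2")
    case True
    define k where "k = i + j - 2"
    have one: "lie (x (Suc a)) (x b) = - lie (x a) (x (Suc b))" if "a + b = Suc k" for a b
      using lie_jacobi[of Z "x a" "x b"] less[of a b] that True
      by (simp add: k_def lie_Z_x eq_neg_iff_add_eq_0)
    have two: "lie (x (a + 2)) (x b) = - lie (x a) (x (b + 2))" if "a + b = k" for a b
    proof -
      have z: "lie (x a) (x b) = 0" using less[of a b] that True by (simp add: k_def)
      have "0 = 2 * lie (Q 0) (lie (x a) (x b))" by (simp add: z)
      also have "\<dots> = lie (2 * lie (Q 0) (x a)) (x b) + lie (x a) (2 * lie (Q 0) (x b))"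
        by (simp add: lie_jacobi[of "Q 0"] distrib_left)
      also have "\<dots> = - lie (x (a + 2)) (x b) - lie (x a) (x (b + 2))"
        unfolding two_lie_Q0_x by (simp add: z)
      finally show ?thesis by (simp add: algebra_simps eq_neg_iff_add_eq_0)
    qed
    have three: "lie (x a) (x (b + 2)) = 0" if "a + b = k" for a b
    proof -
      have "lie (x (a + 2)) (x b) = lie (x a) (x (b + 2))"
        using one[of "Suc a" b] one[of a "Suc b"] that by simp
      then have "2 * lie (x a) (x (b + 2)) = 0" using two[OF that]
        by (simp add: mult_2 eq_neg_iff_add_eq_0)
      then show ?thesis by (rule two_cancel)
    qed
    consider b where "j = b + 2" | a where "i = a + 2" | "i = 1" "j = 1"
      using True by (metis One_nat_def add_2_eq_Suc' not0_implies_Suc numeral_2_eq_2 add.commute add_cancel_right_right le_add2 le_SucE not_less_eq_eq plus_1_eq_Suc)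
    then show ?thesis
    proof cases
      case 1
      then show ?thesis using three[of i b] by (simp add: k_def)
    next
      case 2
      then show ?thesis using three[of j a] lie_swap[of "x i"] by (simp add: k_def)
    qed simp
  next
    case False
    then have "i = j \<or> i = 0 \<and> j = 1 \<or> i = 1 \<and> j = 0" by auto
    then show ?thesis using XZX by (auto simp: lie_Z_x[of 0, simplified, symmetric] lie_swap[of "lie Z X" X])
  qed
qed

lemma lie_y_y: "lie (y i) (y j) = 0"
proof -
  interpret d: onsager Y X "- Z" by (rule dual)
  show ?thesis using d.lie_x_x by (simp add: y_def d.x_def)
qed

lemma two_lie_Q0_y: "2 * lie (Q 0) (y i) = y (i + 2) - 4 * y i"
proof -
  interpret d: onsager Y X "- Z" by (rule dual)
  have "d.Q 0 = - Q 0" by (simp add: d.Q_def Q_0 lie_swap[of Y X])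
  then have "- (2 * lie (Q 0) (y i)) = 4 * y i - y (i + 2)"
    using d.two_lie_Q0_x[of i] by (simp add: y_def d.x_def)
  then show ?thesis by (metis minus_diff_eq minus_minus)
qed

lemma lie_Z_xy: "lie Z (lie (x i) (y j)) = lie (x (Suc i)) (y j) - lie (x i) (y (Suc j))"
  by (simp add: lie_jacobi[of Z] lie_Z_x lie_Z_y)

lemma lie_xy_x: "lie (lie (x i) (y j)) (x l) = lie (lie (x l) (y j)) (x i)"
proof -
  have "lie (lie (x i) (y j)) (x l) = lie (x i) (lie (y j) (x l))"
    using lie_jacobi[of "x i" "y j" "x l"] by (simp add: lie_x_x)
  also have "\<dots> = lie (lie (x l) (y j)) (x i)"
    using lie_swap[of "y j" "x l"] lie_swap[of "x i" "lie (x l) (y j)"] by simp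
  finally show ?thesis .
qed

lemma lie_xy_y: "lie (lie (x l) (y i)) (y j) = lie (lie (x l) (y j)) (y i)"
  using lie_jacobi[of "x l" "y i" "y j"] lie_swap[of "y i" "lie (x l) (y j)"] by (simp add: lie_y_y)

lemma two_lie_Q0_xy:
  "2 * lie (Q 0) (lie (x i) (y j)) = lie (x i) (y (j + 2)) - lie (x (i + 2)) (y j)"
proof -
  have "2 * lie (Q 0) (lie (x i) (y j)) = lie (2 * lie (Q 0) (x i)) (y j) + lie (x i) (2 * lie (Q 0) (y j))"
    by (simp add: lie_jacobi[of "Q 0"] distrib_left)
  then show ?thesis unfolding two_lie_Q0_x two_lie_Q0_y by simp
qed

text \<open>The inductive step evaluates \<open>[Q 0, Q k]\<close> in two ways; with \<open>\<delta> = [Z, Q (k + 1)]\<close> the comparison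
  yields \<open>(k + 4) \<delta> = 0\<close>.\<close>

lemma Q_collapse: "(\<forall>i j. i + j = k \<longrightarrow> lie (x i) (y j) = Q k) \<and> lie Z (Q k) = 0"
proof (induction k rule: less_induct)
  case (less k)
  show ?case
  proof (cases k)
    case 0
    then show ?thesis using ZXY by (simp add: Q_0)
  next
    case k: (Suc k')
    have IH: "lie (x i) (y j) = Q k'" if "i + j = k'" for i j using less[of k'] k that by simp
    have "lie (x (Suc i)) (y j) = lie (x i) (y (Suc j))" if "i + j = k'" for i j
      using lie_Z_xy[of i j] IH[OF that] less[of k'] k by simp
    then have step: "lie (x i) (y j) = Q k" if "i + j = k" for i j
      using that
    proof (induction j arbitrary: i)
      case 0
      then show ?case by (simp add: Q_def)
    next
      case (Suc j)
      then show ?case using k by (metis add_Suc_right add_Suc nat.inject)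
    qed
    define \<delta> where "\<delta> = lie Z (Q k)"
    have d: "lie (x i) (y (Suc j)) = lie (x (Suc i)) (y j) - \<delta>" if "i + j = k" for i j
      using lie_Z_xy[of i j] step[OF that] by (simp add: \<delta>_def)
    have dn: "lie (x i) (y j) = Q (Suc k) - of_nat j * \<delta>" if "i + j = Suc k" for i j
      using that
    proof (induction j arbitrary: i)
      case 0
      then show ?case by (simp add: Q_def)
    next
      case (Suc j)
      then show ?case using d[of i j] Suc.IH[of "Suc i"] by (simp add: algebra_simps)
    qed
    have Q_k': "Q k' = lie (x k') (y 0)" "Q k' = lie (x 0) (y k')" using IH by (simp_all del: x_0 y_0)
    have "2 * lie (Q 0) (Q k') = lie (x k') (y 2) - lie (x (k' + 2)) (y 0)"
      using two_lie_Q0_xy[of k' 0] by (simp add: Q_k'(1) numeral_2_eq_2)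
    also have "\<dots> = - (2 * \<delta>)" using dn[of k' 2] dn[of "k' + 2" 0] k by simp
    finally have 1: "2 * lie (Q 0) (Q k') = - (2 * \<delta>)" .
    have x: "lie (Q k') X = lie (Q 0) (x k')"
      using lie_xy_x[of k' 0 0] by (simp add: Q_k'(1) Q_0)
    have y: "lie (Q k') Y = lie (Q 0) (y k')"
      using lie_xy_y[of 0 k' 0] Q_k'(2) by (simp add: Q_0)
    have "2 * lie (Q k') (Q 0) = lie (2 * lie (Q k') X) Y + lie X (2 * lie (Q k') Y)"
      by (simp add: Q_0 lie_jacobi[of "Q k'"] distrib_left)
    also have "\<dots> = 4 * (lie (x k') (y 0) - lie (x 0) (y k')) + lie (x 0) (y (k' + 2)) - lie (x (k' + 2)) (y 0)"
      unfolding x y two_lie_Q0_x two_lie_Q0_y by (simp add: algebra_simps)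
    also have "\<dots> = - (of_nat (k' + 2) * \<delta>)"
      using dn[of 0 "k' + 2"] dn[of "k' + 2" 0] k IH[of k' 0] IH[of 0 k'] by simp
    finally have 2: "2 * lie (Q k') (Q 0) = - (of_nat (k' + 2) * \<delta>)" .
    have "of_nat (Suc (k' + 3)) * \<delta> = 2 * \<delta> + of_nat (k' + 2) * \<delta>"
      by (simp add: algebra_simps) (simp flip: distrib_right mult_2 add.assoc)
    also have "\<dots> = - (2 * lie (Q 0) (Q k')) - 2 * lie (Q k') (Q 0)"
      unfolding 1 2 by simp
    also have "\<dots> = 0" by (simp add: lie_swap[of "Q k'"])
    finally have "\<delta> = 0" by (rule tf)
    then show ?thesis using step by (simp add: \<delta>_def)
  qed
qed

lemma lie_x_y: "lie (x i) (y j) = Q (i + j)"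
  using Q_collapse by blast

lemma lie_Z_Q: "lie Z (Q k) = 0"
  using Q_collapse by blast

lemma two_lie_Q_y: "2 * lie (Q i) (y j) = y (i + j + 2) - 4 * y (i + j)"
proof -
  have "lie (Q i) (y j) = lie (Q 0) (y (i + j))"
  proof (induction j)
    case 0
    show ?case using lie_xy_y[of 0 i 0] by (simp add: lie_x_y[of 0, simplified] Q_0)
  next
    case (Suc j)
    have "lie (Q i) (y (Suc j)) = - lie Z (lie (Q i) (y j))"
      by (simp add: lie_jacobi[of Z] lie_Z_Q lie_Z_y)
    then show ?case unfolding Suc by (simp add: lie_jacobi[of Z] lie_Z_Q lie_Z_y)
  qed
  then show ?thesis using two_lie_Q0_y[of "i + j"] by simp
qed

lemma two_lie_Q_X: "2 * lie (Q i) X = 4 * x i - x (i + 2)"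
  using lie_xy_x[of i 0 0] two_lie_Q0_x[of i] by (simp add: Q_def)

lemma lie_Q_Q: "lie (Q i) (Q j) = 0"
proof -
  have "2 * lie (Q i) (Q j) = 2 * lie (Q i) (lie X (y j))"
    using lie_x_y[of 0 j] by simp
  also have "\<dots> = lie (2 * lie (Q i) X) (y j) + lie X (2 * lie (Q i) (y j))"
    by (simp add: lie_jacobi[of "Q i"] distrib_left)
  also have "\<dots> = 0"
    unfolding two_lie_Q_X two_lie_Q_y
    using lie_x_y[of 0] by (simp add: lie_x_y)
  finally show ?thesis by (rule two_cancel)
qed

end

hide_const (open) Module.smult

section \<open>Linear operators on sequences\<close>

definition fscale :: "'a::field \<Rightarrow> (nat \<Rightarrow> 'a) \<Rightarrow> (nat \<Rightarrow> 'a)" (infixr \<open>*f\<close> 75) where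
  "c *f w = (\<lambda>i. c * w i)"

lemma fscale_apply: "(c *f w) i = c * w i"
  by (simp add: fscale_def)

lemmas pointwise = fscale_apply plus_fun_apply zero_fun_apply minus_apply uminus_apply

declare plus_fun_apply [simp del] zero_fun_apply [simp del] minus_apply [simp del] uminus_apply [simp del]

global_interpretation fs: vector_space fscale
  by standard (simp_all add: fun_eq_iff pointwise algebra_simps)

typedef (overloaded) 'a lin = "{T :: (nat \<Rightarrow> 'a::field) \<Rightarrow> (nat \<Rightarrow> 'a).
    (\<forall>v w. T (v + w) = T v + T w) \<and> (\<forall>c v. T (c *f v) = c *f T v)}"
  morphisms ap Lin
  by (rule exI[of _ "\<lambda>w. w"]) simp

setup_lifting type_definition_lin

lemma ap_add_right [simp]: "ap T (v + w) = ap T v + ap T w"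
  and ap_scale_right [simp]: "ap T (c *f v) = c *f ap T v"
  using ap[of T] by simp_all

lemma ap_zero_right [simp]: "ap T 0 = 0"
  using ap_add_right[of T 0 0] by simp

lemma ap_minus_right [simp]: "ap T (- v) = - ap T v"
  using ap_add_right[of T v "- v"] by (simp add: eq_neg_iff_add_eq_0 add.commute)

lemma ap_diff_right [simp]: "ap T (v - w) = ap T v - ap T w"
  using ap_add_right[of T v "- w"] by simp

lemma ap_sum_right: "ap T (sum g I) = (\<Sum>i\<in>I. ap T (g i))"
  by (rule sum_comp_morphism[symmetric, unfolded comp_def, of "ap T"]) simp_all

instantiation lin :: (field) ring_1
begin

lift_definition zero_lin :: "'a lin" is "\<lambda>w. 0" by simp
lift_definition one_lin :: "'a lin" is "\<lambda>w. w" by simp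
lift_definition plus_lin :: "'a lin \<Rightarrow> 'a lin \<Rightarrow> 'a lin" is "\<lambda>S T w. S w + T w"
  by (simp add: fs.scale_right_distrib add_ac)
lift_definition minus_lin :: "'a lin \<Rightarrow> 'a lin \<Rightarrow> 'a lin" is "\<lambda>S T w. S w - T w"
  by (simp add: fs.scale_right_diff_distrib)
lift_definition uminus_lin :: "'a lin \<Rightarrow> 'a lin" is "\<lambda>T w. - T w"
  by simp
lift_definition times_lin :: "'a lin \<Rightarrow> 'a lin \<Rightarrow> 'a lin" is "\<lambda>S T w. S (T w)"
  by simp

instance
proof
  fix a b c :: "'a lin"
  show "a * b * c = a * (b * c)" by transfer simp
  show "1 * a = a" "a * 1 = a" by (transfer, simp)+
  show "a + b + c = a + (b + c)" by transfer (simp add: add.assoc)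
  show "a + b = b + a" by transfer (simp add: add.commute)
  show "0 + a = a" "- a + a = 0" "a - b = a + - b" by (transfer, simp add: fun_eq_iff pointwise)+
  show "(a + b) * c = a * c + b * c" by transfer simp
  show "a * (b + c) = a * b + a * c" by transfer simp
  show "(0::'a lin) \<noteq> 1"
  proof transfer
    show "(\<lambda>w. 0) \<noteq> (\<lambda>w :: nat \<Rightarrow> 'a. w)"
      using fun_cong[of "\<lambda>w :: nat \<Rightarrow> 'a. 0" "\<lambda>w. w" "\<lambda>i. 1"] fun_cong[of "0 :: nat \<Rightarrow> 'a" "\<lambda>i. 1" 0]
      by (auto simp: pointwise)
  qed
qed

end

lemma ap_zero [simp]: "ap 0 w = 0" and ap_one [simp]: "ap 1 w = w"
  and ap_add [simp]: "ap (S + T) w = ap S w + ap T w"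
  and ap_diff [simp]: "ap (S - T) w = ap S w - ap T w"
  and ap_minus [simp]: "ap (- T) w = - ap T w"
  and ap_mult [simp]: "ap (S * T) w = ap S (ap T w)"
  by (transfer, simp)+

lemma lin_eqI: "(\<And>w. ap S w = ap T w) \<Longrightarrow> S = T"
  by transfer (simp add: fun_eq_iff)

lemma ap_of_nat [simp]: "ap (of_nat k) w = of_nat k *f w"
  by (induction k) (simp_all add: fs.scale_left_distrib)

lemma ap_numeral [simp]: "ap (numeral k) w = numeral k *f w"
  using ap_of_nat[of "numeral k" w] by simp

lemma ap_sum: "ap (sum T I) w = (\<Sum>i\<in>I. ap (T i) w)"
  by (rule sum_comp_morphism[symmetric, unfolded comp_def, of "\<lambda>T. ap T w"]) simp_all

lift_definition sc :: "'a::field \<Rightarrow> 'a lin" is "\<lambda>c w. c *f w"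
  by (simp add: fs.scale_right_distrib mult.commute)

lemma ap_sc [simp]: "ap (sc c) w = c *f w"
  by transfer simp

lemma sc_commute: "sc c * T = T * sc c"
  by (rule lin_eqI) simp

lemma sc_add: "sc (a + b) = sc a + sc b" and sc_mult: "sc (a * b) = sc a * sc b"
  and sc_minus: "sc (- a) = - sc a" and sc_zero [simp]: "sc 0 = 0" and sc_one [simp]: "sc 1 = 1"
  by (rule lin_eqI, simp add: algebra_simps fun_eq_iff pointwise)+

lemma lie_sc [simp]: "lie (sc c * S) T = sc c * lie S T" "lie S (sc c * T) = sc c * lie S T"
  by (rule lie_scale, rule sc_commute)+

lemma lin_torsion_free:
  assumes "of_nat (Suc n) * (T :: 'a::field_char_0 lin) = 0"
  shows "T = 0"
proof (rule lin_eqI)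
  fix w
  have "ap (of_nat (Suc n) * T) w = 0" using assms by simp
  then have "of_nat (Suc n) *f ap T w = 0" by (metis ap_mult ap_of_nat)
  then show "ap T w = ap 0 w" by (simp add: fs.scale_eq_0_iff del: of_nat_Suc)
qed

definition poly_comb :: "(nat \<Rightarrow> 'a::field lin) \<Rightarrow> 'a poly \<Rightarrow> 'a lin" where
  "poly_comb g p = (\<Sum>i\<le>degree p. sc (coeff p i) * g i)"

lemma poly_comb_bound:
  assumes "degree p \<le> n"
  shows "poly_comb g p = (\<Sum>i\<le>n. sc (coeff p i) * g i)"
  unfolding poly_comb_def
  using assms by (intro sum.mono_neutral_left) (auto simp: coeff_eq_0)

lemma poly_comb_0 [simp]: "poly_comb g 0 = 0"
  by (simp add: poly_comb_def)

lemma poly_comb_add: "poly_comb g (p + q) = poly_comb g p + poly_comb g q"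
proof -
  let ?n = "max (degree p) (degree q)"
  have "degree (p + q) \<le> ?n" by (rule degree_add_le_max)
  then show ?thesis
    by (simp add: poly_comb_bound[of _ ?n] sc_add distrib_right sum.distrib)
qed

lemma poly_comb_smult: "poly_comb g (smult c p) = sc c * poly_comb g p"
  unfolding poly_comb_bound[OF degree_smult_le] poly_comb_def[of g p] sum_distrib_left
  by (simp add: sc_mult mult.assoc)

lemma poly_comb_pCons: "poly_comb g (pCons a p) = sc a * g 0 + poly_comb (\<lambda>i. g (Suc i)) p"
proof -
  have "poly_comb g (pCons a p) = (\<Sum>i\<le>Suc (degree p). sc (coeff (pCons a p) i) * g i)"
    by (rule poly_comb_bound) (rule degree_pCons_le)
  also have "\<dots> = sc a * g 0 + poly_comb (\<lambda>i. g (Suc i)) p"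
    by (simp only: sum.atMost_Suc_shift poly_comb_def coeff_pCons_0 coeff_pCons_Suc)
  finally show ?thesis .
qed

lemma poly_comb_minus: "poly_comb g (- p) = - poly_comb g p"
  by (simp add: poly_comb_def sc_minus sum_negf)

lemma poly_comb_diff: "poly_comb g (p - q) = poly_comb g p - poly_comb g q"
  using poly_comb_add[of g p "- q"] by (simp add: poly_comb_minus)

lemma poly_comb_const [simp]: "poly_comb g [:a:] = sc a * g 0"
  by (simp add: poly_comb_pCons)

lemma poly_comb_shift: "poly_comb g (pCons 0 p) = poly_comb (\<lambda>i. g (Suc i)) p"
  by (simp add: poly_comb_pCons)

lemma poly_comb_linear_seq:
  "poly_comb (\<lambda>i. g i + h i) p = poly_comb g p + poly_comb h p"
  "poly_comb (\<lambda>i. - g i) p = - poly_comb g p"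
  "poly_comb (\<lambda>i. sc c * g i) p = sc c * poly_comb g p"
proof -
  show "poly_comb (\<lambda>i. sc c * g i) p = sc c * poly_comb g p"
    unfolding poly_comb_def sum_distrib_left
    by (intro sum.cong refl) (metis mult.assoc sc_commute)
qed (simp_all add: poly_comb_def distrib_left sum.distrib sum_negf)

lemma lie_sum: "lie (sum g I) T = (\<Sum>i\<in>I. lie (g i) T)" "lie T (sum g I) = (\<Sum>i\<in>I. lie T (g i))"
  by (simp_all add: lie_def sum_distrib_left sum_distrib_right sum_subtractf)

lemma lie_poly_comb:
  "lie (poly_comb g p) T = poly_comb (\<lambda>i. lie (g i) T) p"
  "lie T (poly_comb g p) = poly_comb (\<lambda>i. lie T (g i)) p"
  by (simp_all add: poly_comb_def lie_sum)

lemma poly_comb_convolve: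
  "poly_comb (\<lambda>i. poly_comb (\<lambda>j. g (i + j)) q) p = poly_comb g (p * q)"
proof (induction p arbitrary: g)
  case (pCons a p)
  show ?case using pCons(2)[of "\<lambda>i. g (Suc i)"]
    by (simp add: poly_comb_pCons poly_comb_add poly_comb_smult)
qed simp

lemma lie_poly_comb_convolve:
  assumes "\<And>i j. lie (g i) (h j) = k (i + j)"
  shows "lie (poly_comb g p) (poly_comb h q) = poly_comb k (p * q)"
  by (simp add: lie_poly_comb(1)) (simp add: lie_poly_comb(2) assms poly_comb_convolve)

section \<open>Eigenvectors\<close>

lemma joint_eigenvectors_independent:
  assumes eig: "\<And>e j. e \<in> E \<Longrightarrow> j \<in> J \<Longrightarrow> \<exists>c. ap (h j) e = c *f e"
    and sep: "\<And>e. e \<in> E \<Longrightarrow> \<exists>j\<in>J. \<exists>c. ap (h j) e = c *f e \<and> c \<noteq> \<theta> j"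
    and w: "w \<in> fs.span E" "\<And>j. j \<in> J \<Longrightarrow> ap (h j) w = \<theta> j *f w"
  shows "w = 0"
proof -
  obtain t u where t: "finite t" "t \<subseteq> E" and wt: "w = (\<Sum>e\<in>t. u e *f e)"
    using w(1) by (auto simp: fs.span_explicit)
  from t(1) show ?thesis using t(2) wt w(2)
  proof (induction t arbitrary: u w rule: finite_induct)
    case empty
    then show ?case by simp
  next
    case (insert e0 t)
    obtain j c where j: "j \<in> J" "ap (h j) e0 = c *f e0" "c \<noteq> \<theta> j"
      using sep insert.prems(1) by blast
    obtain \<mu> where \<mu>: "\<And>e. e \<in> E \<Longrightarrow> ap (h j) e = \<mu> e *f e"
      using eig[OF _ j(1)] by metis
    have "(\<theta> j - c) *f w = ap (h j) w - c *f w"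
      using insert.prems(3)[OF j(1)] by (simp add: fs.scale_left_diff_distrib)
    also have "\<dots> = (\<Sum>e\<in>insert e0 t. u e *f (ap (h j) e - c *f e))"
      unfolding insert.prems(2)
      by (simp only: ap_sum_right ap_scale_right fs.scale_sum_right fs.scale_right_diff_distrib
          sum_subtractf fs.scale_left_commute)
    also have "\<dots> = (\<Sum>e\<in>t. u e *f (ap (h j) e - c *f e))"
      by (subst sum.insert) (use insert.hyps j(2) in simp_all)
    also have "\<dots> = (\<Sum>e\<in>t. (u e * (\<mu> e - c)) *f e)"
    proof (intro sum.cong refl)
      fix e assume "e \<in> t"
      then have "ap (h j) e = \<mu> e *f e" using \<mu> insert.prems(1) by auto
      then show "u e *f (ap (h j) e - c *f e) = (u e * (\<mu> e - c)) *f e"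
        by (simp add: fs.scale_left_diff_distrib[symmetric])
    qed
    finally have w': "(\<theta> j - c) *f w = (\<Sum>e\<in>t. (u e * (\<mu> e - c)) *f e)" .
    have "(\<theta> j - c) *f w = 0"
    proof (rule insert.IH)
      show "t \<subseteq> E" using insert.prems(1) by simp
      show "(\<theta> j - c) *f w = (\<Sum>e\<in>t. (u e * (\<mu> e - c)) *f e)" by (rule w')
      show "ap (h k) ((\<theta> j - c) *f w) = \<theta> k *f ((\<theta> j - c) *f w)" if "k \<in> J" for k
        using insert.prems(3)[OF that] by (simp add: mult.commute)
    qed
    then show ?case using j(3) by (simp add: fs.scale_eq_0_iff)
  qed
qed

lemma poly_comb_monom: "poly_comb g (monom c i) = sc c * g i"
proof (cases "c = 0")
  case False
  have "poly_comb g (monom c i) = (\<Sum>k\<in>{i}. sc (coeff (monom c i) k) * g k)"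
    unfolding poly_comb_def using False
    by (intro sum.mono_neutral_right) (auto simp: degree_monom_eq)
  then show ?thesis by simp
qed simp

lemma poly_comb_sum: "poly_comb g (sum p I) = (\<Sum>i\<in>I. poly_comb g (p i))"
  by (rule sum_comp_morphism[symmetric, unfolded comp_def, of "poly_comb g"]) (simp_all add: poly_comb_add)

lemma poly_comb_annihilates:
  assumes "finite B" and g: "\<And>k. ap (g k) w \<in> fs.span B"
  shows "\<exists>p. p \<noteq> 0 \<and> ap (poly_comb g p) w = 0"
proof (cases "inj_on (\<lambda>k. ap (g k) w) {..card B}")
  case False
  then obtain i j where ij: "ap (g i) w = ap (g j) w" "i \<noteq> j"
    by (auto simp: inj_on_def)
  have "monom 1 i - monom 1 j \<noteq> (0 :: 'a poly)"
    using ij(2) by (simp add: monom_eq_iff')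
  then show ?thesis
    using ij(1) by (intro exI[of _ "monom 1 i - monom 1 j"]) (simp add: poly_comb_diff poly_comb_monom)
next
  case inj: True
  let ?S = "(\<lambda>k. ap (g k) w) ` {..card B}"
  have "fs.dependent ?S"
  proof (rule ccontr)
    assume "\<not> fs.dependent ?S"
    then have "card ?S \<le> card B"
      using fs.independent_span_bound[OF assms(1), of ?S] g by blast
    then show False using card_image[OF inj] by simp
  qed
  then obtain u where u: "\<exists>v\<in>?S. u v \<noteq> 0" "(\<Sum>v\<in>?S. u v *f v) = 0"
    by (auto simp: fs.dependent_finite)
  define p where "p = (\<Sum>i\<le>card B. monom (u (ap (g i) w)) i)"
  have c: "coeff p i = (if i \<le> card B then u (ap (g i) w) else 0)" for i
    by (simp add: p_def coeff_sum)
  obtain i where "i \<le> card B" "u (ap (g i) w) \<noteq> 0" using u(1) by blast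
  then have "coeff p i \<noteq> 0" by (simp add: c)
  then have "p \<noteq> 0" by auto
  moreover have "ap (poly_comb g p) w = (\<Sum>i\<le>card B. u (ap (g i) w) *f ap (g i) w)"
    by (simp add: p_def poly_comb_sum poly_comb_monom ap_sum)
  moreover have "\<dots> = 0"
    using u(2) by (simp add: sum.reindex[OF inj] comp_def)
  ultimately show ?thesis by auto
qed

definition preserves :: "(nat \<Rightarrow> 'a) set \<Rightarrow> 'a::field lin \<Rightarrow> bool" where
  "preserves U T \<longleftrightarrow> (\<forall>u\<in>U. ap T u \<in> U)"

lemma preservesD: "preserves U T \<Longrightarrow> u \<in> U \<Longrightarrow> ap T u \<in> U"
  by (simp add: preserves_def)

context
  fixes U :: "(nat \<Rightarrow> 'a::field) set"
  assumes U: "fs.subspace U"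
begin

lemma preserves_add: "preserves U S \<Longrightarrow> preserves U T \<Longrightarrow> preserves U (S + T)"
  and preserves_diff: "preserves U S \<Longrightarrow> preserves U T \<Longrightarrow> preserves U (S - T)"
  and preserves_minus: "preserves U T \<Longrightarrow> preserves U (- T)"
  and preserves_mult: "preserves U S \<Longrightarrow> preserves U T \<Longrightarrow> preserves U (S * T)"
  and preserves_sc: "preserves U (sc c)"
  by (simp_all add: preserves_def fs.subspace_add[OF U] fs.subspace_diff[OF U] fs.subspace_neg[OF U]
      fs.subspace_scale[OF U])

lemma preserves_lie: "preserves U S \<Longrightarrow> preserves U T \<Longrightarrow> preserves U (lie S T)"
  unfolding lie_def by (intro preserves_diff preserves_mult)

lemma preserves_sum: "(\<And>i. i \<in> I \<Longrightarrow> preserves U (g i)) \<Longrightarrow> preserves U (sum g I)"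
  by (simp add: preserves_def ap_sum fs.subspace_sum[OF U])

lemma preserves_poly_comb: "(\<And>i. preserves U (g i)) \<Longrightarrow> preserves U (poly_comb g p)"
  unfolding poly_comb_def by (intro preserves_sum preserves_mult preserves_sc)

lemma preserves_power: "preserves U T \<Longrightarrow> preserves U (T ^ k)"
  by (induction k) (simp_all add: preserves_def)

end

lemma eigenvector_exists:
  assumes closed: "alg_closed_field TYPE('a::field)"
    and U: "fs.subspace U" "U \<subseteq> fs.span B" "finite B" "U \<noteq> {0}"
    and T: "preserves U (T :: 'a lin)"
  shows "\<exists>v\<in>U. v \<noteq> 0 \<and> (\<exists>c. ap T v = c *f v)"
proof -
  obtain w where w: "w \<in> U" "w \<noteq> 0" using fs.subspace_0[OF U(1)] U(4) by auto
  have pres: "preserves U (poly_comb (\<lambda>k. T ^ k) p)" for p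
    by (intro preserves_poly_comb preserves_power U T)
  let ?P = "\<lambda>p. p \<noteq> 0 \<and> ap (poly_comb (\<lambda>k. T ^ k) p) w = 0"
  have "\<exists>p. ?P p"
  proof (rule poly_comb_annihilates[OF U(3)])
    show "ap (T ^ k) w \<in> fs.span B" for k
      using preservesD[OF preserves_power[OF U(1) T] w(1)] U(2) by blast
  qed
  then obtain p where p: "?P p" and min: "\<And>q. ?P q \<Longrightarrow> degree p \<le> degree q"
    using ex_has_least_nat[of ?P _ degree] by blast
  have "degree p > 0"
  proof (rule ccontr)
    assume "\<not> degree p > 0"
    then obtain c where "p = [:c:]" using degree_eq_zeroE by blast
    then show False using p w(2) by (simp add: fs.scale_eq_0_iff)
  qed
  then obtain a where "poly p a = 0" using closed by (auto simp: alg_closed_field_def)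
  then obtain q where q: "p = [:- a, 1:] * q" by (auto simp: poly_eq_0_iff_dvd elim: dvdE)
  then have "q \<noteq> 0" using p by auto
  then have dq: "degree q < degree p" unfolding q by (subst degree_mult_eq) auto
  define u where "u = ap (poly_comb (\<lambda>k. T ^ k) q) w"
  have "u \<noteq> 0" using min[of q] dq \<open>q \<noteq> 0\<close> by (auto simp: u_def)
  moreover have "u \<in> U" unfolding u_def using preservesD[OF pres w(1)] .
  moreover have "ap T u = a *f u"
  proof -
    have "poly_comb (\<lambda>k. T ^ Suc k) q = T * poly_comb (\<lambda>k. T ^ k) q"
      unfolding poly_comb_def sum_distrib_left
      by (intro sum.cong refl) (simp add: mult.assoc[symmetric] sc_commute[of _ T])
    moreover have "p = pCons 0 q - smult a q" by (simp add: q)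
    ultimately have "poly_comb (\<lambda>k. T ^ k) p = T * poly_comb (\<lambda>k. T ^ k) q - sc a * poly_comb (\<lambda>k. T ^ k) q"
      by (simp only: poly_comb_diff poly_comb_shift poly_comb_smult)
    then show ?thesis using p by (simp add: u_def)
  qed
  ultimately show ?thesis by blast
qed

lemma fs_dim_strict_mono:
  assumes "fs.subspace U'" "U' \<subset> U" "U \<subseteq> fs.span B" "finite B"
  shows "fs.dim U' < fs.dim U"
proof -
  obtain C where C: "C \<subseteq> U'" "fs.independent C" "U' \<subseteq> fs.span C" "card C = fs.dim U'"
    using fs.basis_exists by blast
  obtain w where w: "w \<in> U" "w \<notin> U'" using assms(2) by blast
  then have "w \<notin> fs.span C" using fs.span_minimal[OF C(1) assms(1)] by blast
  then have "fs.independent (insert w C)" using C(2) by (rule fs.independent_insertI)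
  moreover have "insert w C \<subseteq> U" using C(1) assms(2) w(1) by auto
  ultimately obtain D where D: "insert w C \<subseteq> D" "D \<subseteq> U" "fs.independent D" "U \<subseteq> fs.span D"
    using fs.maximal_independent_subset_extend by metis
  have "finite D" using fs.independent_span_bound[OF assms(4) D(3)] D(2) assms(3) by auto
  then have "card (insert w C) \<le> fs.dim U" "finite C"
    using D(1) card_mono[OF _ D(1)] fs.basis_card_eq_dim[OF D(2,4,3)] by (auto intro: finite_subset)
  moreover have "w \<notin> C" using C(1) w(2) by auto
  ultimately show ?thesis using C(4) by simp
qed

lemma common_eigenvector:
  assumes closed: "alg_closed_field TYPE('a::field)" and B: "finite B"
    and "fs.subspace U" "U \<subseteq> fs.span B" "U \<noteq> {0}"
    and "\<And>T. T \<in> F \<Longrightarrow> preserves U (T :: 'a lin)"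
    and "\<And>S T u. S \<in> F \<Longrightarrow> T \<in> F \<Longrightarrow> u \<in> U \<Longrightarrow> ap S (ap T u) = ap T (ap S u)"
  shows "\<exists>v\<in>U. v \<noteq> 0 \<and> (\<forall>T\<in>F. \<exists>c. ap T v = c *f v)"
  using assms(3-)
proof (induction "fs.dim U" arbitrary: U rule: less_induct)
  case less
  show ?case
  proof (cases "\<forall>T\<in>F. \<exists>c. \<forall>u\<in>U. ap T u = c *f u")
    case True
    obtain v where "v \<in> U" "v \<noteq> 0"
      using fs.subspace_0[OF less.prems(1)] less.prems(3) by auto
    then show ?thesis using True by (intro bexI[of _ v] conjI ballI) blast+
  next
    case False
    then obtain T where T: "T \<in> F" "\<And>c. \<exists>u\<in>U. ap T u \<noteq> c *f u" by blast
    obtain v c where v: "v \<in> U" "v \<noteq> 0" "ap T v = c *f v"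
      using eigenvector_exists[OF closed less.prems(1,2) B less.prems(3,4)] T(1) by blast
    define U' where "U' = {u \<in> U. ap T u = c *f u}"
    have sub: "fs.subspace U'"
      using less.prems(1) unfolding U'_def fs.subspace_def
      by (auto simp: fs.scale_right_distrib mult.commute)
    have "U' \<subseteq> U" by (auto simp: U'_def)
    have "U' \<subset> U" using T(2)[of c] unfolding U'_def by blast
    then have "fs.dim U' < fs.dim U" using fs_dim_strict_mono[OF sub _ less.prems(2) B] by blast
    moreover have "preserves U' S" if "S \<in> F" for S
      using less.prems(4)[OF that] less.prems(5)[OF T(1) that] by (auto simp: preserves_def U'_def)
    moreover have "U' \<noteq> {0}" using v by (auto simp: U'_def)
    moreover have "ap R (ap S u) = ap S (ap R u)" if "R \<in> F" "S \<in> F" "u \<in> U'" for R S u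
      using less.prems(5)[OF that(1,2)] that(3) by (simp add: U'_def)
    moreover have "U' \<subseteq> fs.span B" using \<open>U' \<subseteq> U\<close> less.prems(2) by blast
    ultimately have "\<exists>w\<in>U'. w \<noteq> 0 \<and> (\<forall>T\<in>F. \<exists>c. ap T w = c *f w)"
      by (intro less.hyps sub)
    then show ?thesis using \<open>U' \<subseteq> U\<close> by blast
  qed
qed

section \<open>Cyclic modules over commuting copies of sl2\<close>

locale commuting_sl2 =
  fixes V :: "(nat \<Rightarrow> 'a::field_char_0) set" and J :: "'i set"
    and e f h :: "'i \<Rightarrow> 'a lin" and v :: "nat \<Rightarrow> 'a" and \<mu> :: "'i \<Rightarrow> 'a"
  assumes V: "fs.subspace V" and J: "finite J"
    and pres_f: "a \<in> J \<Longrightarrow> preserves V (f a)"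
    and ff: "a \<in> J \<Longrightarrow> b \<in> J \<Longrightarrow> w \<in> V \<Longrightarrow> ap (f a) (ap (f b) w) = ap (f b) (ap (f a) w)"
    and ef: "a \<in> J \<Longrightarrow> b \<in> J \<Longrightarrow> w \<in> V \<Longrightarrow>
      ap (e a) (ap (f b) w) = ap (f b) (ap (e a) w) + (if a = b then ap (h a) w else 0)"
    and hf: "a \<in> J \<Longrightarrow> b \<in> J \<Longrightarrow> w \<in> V \<Longrightarrow>
      ap (h a) (ap (f b) w) = ap (f b) (ap (h a) w) - (if a = b then 2 *f ap (f b) w else 0)"
    and v: "v \<in> V" "v \<noteq> 0"
    and ev: "a \<in> J \<Longrightarrow> ap (e a) v = 0"
    and hv: "a \<in> J \<Longrightarrow> ap (h a) v = \<mu> a *f v"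
    and nilpotent: "a \<in> J \<Longrightarrow> \<exists>k. (ap (f a) ^^ k) v = 0"
begin

fun M :: "'i list \<Rightarrow> ('i \<Rightarrow> nat) \<Rightarrow> nat \<Rightarrow> 'a" where
  "M [] g = v"
| "M (a # as) g = (ap (f a) ^^ g a) (M as g)"

lemma pow_in_V: "a \<in> J \<Longrightarrow> w \<in> V \<Longrightarrow> (ap (f a) ^^ k) w \<in> V"
  by (induction k) (simp_all add: preservesD[OF pres_f])

lemma M_in_V: "set as \<subseteq> J \<Longrightarrow> M as g \<in> V"
  by (induction as) (simp_all add: v pow_in_V)

lemma pow_zero [simp]: "(ap T ^^ k) 0 = 0"
  by (induction k) simp_all

lemma f_pow: "a \<in> J \<Longrightarrow> b \<in> J \<Longrightarrow> w \<in> V \<Longrightarrow> ap (f b) ((ap (f a) ^^ k) w) = (ap (f a) ^^ k) (ap (f b) w)"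
  by (induction k) (simp_all add: ff pow_in_V)

lemma h_pow:
  assumes "a \<in> J" "b \<in> J" "w \<in> V" "ap (h b) w = \<nu> *f w"
  shows "ap (h b) ((ap (f a) ^^ k) w) = (\<nu> - 2 * of_nat (if a = b then k else 0)) *f (ap (f a) ^^ k) w"
proof (induction k)
  case 0
  then show ?case using assms by simp
next
  case (Suc k)
  have "ap (h b) ((ap (f a) ^^ Suc k) w) = ap (f a) (ap (h b) ((ap (f a) ^^ k) w))
      - (if b = a then 2 *f (ap (f a) ^^ Suc k) w else 0)"
    using hf[OF assms(2,1) pow_in_V[OF assms(1,3)], of k] by simp
  also have "\<dots> = (\<nu> - 2 * of_nat (if a = b then k else 0)) *f (ap (f a) ^^ Suc k) w
      - (if a = b then 2 else 0) *f (ap (f a) ^^ Suc k) w"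
    unfolding Suc by simp
  also have "\<dots> = ((\<nu> - 2 * of_nat (if a = b then k else 0)) - (if a = b then 2 else 0)) *f (ap (f a) ^^ Suc k) w"
    by (rule fs.scale_left_diff_distrib[symmetric])
  also have "(\<nu> - 2 * of_nat (if a = b then k else 0)) - (if a = b then 2 else 0)
      = \<nu> - 2 * of_nat (if a = b then Suc k else 0)"
    by (simp add: algebra_simps)
  finally show ?case .
qed

lemma e_pow_other:
  "a \<in> J \<Longrightarrow> b \<in> J \<Longrightarrow> a \<noteq> b \<Longrightarrow> w \<in> V \<Longrightarrow> ap (e b) ((ap (f a) ^^ k) w) = (ap (f a) ^^ k) (ap (e b) w)"
  by (induction k) (simp_all add: ef pow_in_V)

lemma e_pow:
  assumes "a \<in> J" "w \<in> V" "ap (h a) w = \<nu> *f w" "ap (e a) w = 0"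
  shows "ap (e a) ((ap (f a) ^^ Suc k) w) = (of_nat (Suc k) * (\<nu> - of_nat k)) *f (ap (f a) ^^ k) w"
proof (induction k)
  case 0
  then show ?case using assms by (simp add: ef)
next
  case (Suc k)
  have "ap (e a) ((ap (f a) ^^ Suc (Suc k)) w)
      = ap (f a) (ap (e a) ((ap (f a) ^^ Suc k) w)) + ap (h a) ((ap (f a) ^^ Suc k) w)"
    using ef[OF assms(1,1) pow_in_V[OF assms(1,2)], of "Suc k"] by simp
  also have "\<dots> = (of_nat (Suc k) * (\<nu> - of_nat k)) *f (ap (f a) ^^ Suc k) w
      + (\<nu> - 2 * of_nat (Suc k)) *f (ap (f a) ^^ Suc k) w"
    unfolding Suc h_pow[OF assms(1,1,2,3)] by simp
  also have "\<dots> = (of_nat (Suc k) * (\<nu> - of_nat k) + (\<nu> - 2 * of_nat (Suc k))) *f (ap (f a) ^^ Suc k) w"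
    by (rule fs.scale_left_distrib[symmetric])
  also have "of_nat (Suc k) * (\<nu> - of_nat k) + (\<nu> - 2 * of_nat (Suc k))
      = of_nat (Suc (Suc k)) * (\<nu> - of_nat (Suc k))"
    by (simp add: algebra_simps)
  finally show ?case .
qed

lemma M_h:
  "distinct as \<Longrightarrow> set as \<subseteq> J \<Longrightarrow> b \<in> J \<Longrightarrow>
    ap (h b) (M as g) = (\<mu> b - 2 * of_nat (if b \<in> set as then g b else 0)) *f M as g"
proof (induction as)
  case (Cons a as)
  then show ?case
    using h_pow[OF _ Cons.prems(3) M_in_V, of a as g "\<mu> b - 2 * of_nat (if b \<in> set as then g b else 0)" "g a"]
    by auto
qed (simp add: hv)

lemma M_e: "set as \<subseteq> J \<Longrightarrow> b \<in> J \<Longrightarrow> b \<notin> set as \<Longrightarrow> ap (e b) (M as g) = 0"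
  by (induction as) (auto simp: ev e_pow_other M_in_V)

definition dd :: "'i \<Rightarrow> nat" where
  "dd a = (LEAST k. (ap (f a) ^^ Suc k) v = 0)"

lemma dd_zero: assumes "a \<in> J" shows "(ap (f a) ^^ Suc (dd a)) v = 0"
proof -
  obtain k where k: "(ap (f a) ^^ k) v = 0" using nilpotent[OF assms] by (elim exE)
  have "k \<noteq> 0"
  proof
    assume "k = 0"
    then show False using k v(2) by simp
  qed
  then obtain l where "k = Suc l" by (rule not0_implies_Suc[THEN exE])
  then have "(ap (f a) ^^ Suc l) v = 0" using k by simp
  then show ?thesis unfolding dd_def by (rule LeastI[where P = "\<lambda>k. (ap (f a) ^^ Suc k) v = 0"])
qed

lemma dd_nonzero: "(ap (f a) ^^ dd a) v \<noteq> 0"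
proof (cases "dd a")
  case (Suc k)
  then have "k < (LEAST k. (ap (f a) ^^ Suc k) v = 0)" unfolding dd_def by simp
  then have "(ap (f a) ^^ Suc k) v \<noteq> 0"
    by (rule not_less_Least[where P = "\<lambda>k. (ap (f a) ^^ Suc k) v = 0"])
  then show ?thesis using Suc by simp
qed (simp add: v)

lemma \<mu>_eq: assumes "a \<in> J" shows "\<mu> a = of_nat (dd a)"
proof -
  have "(of_nat (Suc (dd a)) * (\<mu> a - of_nat (dd a))) *f (ap (f a) ^^ dd a) v = 0"
    using e_pow[OF assms v(1) hv[OF assms] ev[OF assms], of "dd a"] dd_zero[OF assms] by simp
  then have "of_nat (Suc (dd a)) * (\<mu> a - of_nat (dd a)) = 0"
    using dd_nonzero[of a] by (simp only: fs.scale_eq_0_iff) blast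
  then show ?thesis by (simp del: of_nat_Suc)
qed

lemma pow_nonzero:
  assumes "a \<in> J" "w \<in> V" "w \<noteq> 0" "ap (h a) w = of_nat d *f w" "ap (e a) w = 0" "k \<le> d"
  shows "(ap (f a) ^^ k) w \<noteq> 0"
  using assms(6)
proof (induction k)
  case (Suc k)
  show ?case
  proof
    assume "(ap (f a) ^^ Suc k) w = 0"
    then have "(of_nat (Suc k) * (of_nat d - of_nat k)) *f (ap (f a) ^^ k) w = 0"
      using e_pow[OF assms(1,2,4,5), of k] by simp
    moreover have "(ap (f a) ^^ k) w \<noteq> 0" using Suc by simp
    ultimately have "of_nat (Suc k) * (of_nat d - of_nat k) = (0::'a)"
      by (simp only: fs.scale_eq_0_iff) blast
    then show False using Suc.prems by (simp del: of_nat_Suc)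
  qed
qed (simp add: assms)

lemma M_nonzero:
  "distinct as \<Longrightarrow> set as \<subseteq> J \<Longrightarrow> (\<And>a. a \<in> set as \<Longrightarrow> g a \<le> dd a) \<Longrightarrow> M as g \<noteq> 0"
proof (induction as)
  case (Cons a as)
  have "ap (h a) (M as g) = of_nat (dd a) *f M as g"
    using M_h[of as a g] Cons.prems(1,2) by (simp add: \<mu>_eq)
  moreover have "ap (e a) (M as g) = 0" using M_e[of as a g] Cons.prems by simp
  ultimately have "(ap (f a) ^^ g a) (M as g) \<noteq> 0"
    using Cons by (intro pow_nonzero[where d = "dd a"]) (simp_all add: M_in_V)
  then show ?case by simp
qed (simp add: v)

lemma pow_M:
  "a \<in> J \<Longrightarrow> set as \<subseteq> J \<Longrightarrow> (ap (f a) ^^ k) v = 0 \<Longrightarrow> (ap (f a) ^^ k) (M as g) = 0"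
proof (induction as)
  case (Cons b as)
  have "(ap (f a) ^^ k) ((ap (f b) ^^ l) w) = (ap (f b) ^^ l) ((ap (f a) ^^ k) w)" if "w \<in> V" for l w
  proof (induction k)
    case (Suc k)
    have "(ap (f a) ^^ k) w \<in> V" using that Cons.prems(1) by (rule pow_in_V[rotated])
    then have "ap (f a) ((ap (f b) ^^ l) ((ap (f a) ^^ k) w)) = (ap (f b) ^^ l) (ap (f a) ((ap (f a) ^^ k) w))"
      using Cons.prems(1,2) by (intro f_pow) simp_all
    then show ?case by (simp only: funpow.simps comp_apply Suc)
  qed simp
  then show ?case using Cons by (simp add: M_in_V)
qed simp

lemma M_zero: "set as \<subseteq> J \<Longrightarrow> a \<in> set as \<Longrightarrow> g a > dd a \<Longrightarrow> M as g = 0"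
proof (induction as)
  case (Cons b as)
  show ?case
  proof (cases "a = b")
    case True
    define k where "k = g b - Suc (dd b)"
    have k: "g b = k + Suc (dd b)" using Cons.prems(3) True by (simp add: k_def)
    have "(ap (f b) ^^ g b) (M as g) = (ap (f b) ^^ k) ((ap (f b) ^^ Suc (dd b)) (M as g))"
      unfolding k funpow_add by simp
    then show ?thesis
      using pow_M[of b as "Suc (dd b)" g] dd_zero[of b] Cons.prems(1) by simp
  next
    case False
    then show ?thesis using Cons by simp
  qed
qed simp

lemma M_cong: "(\<And>a. a \<in> set as \<Longrightarrow> g a = g' a) \<Longrightarrow> M as g = M as g'"
  by (induction as) simp_all

lemma f_M:
  "distinct as \<Longrightarrow> set as \<subseteq> J \<Longrightarrow> b \<in> set as \<Longrightarrow> ap (f b) (M as g) = M as (g(b := Suc (g b)))"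
proof (induction as)
  case (Cons a as)
  show ?case
  proof (cases "a = b")
    case True
    then have "M as (g(b := Suc (g b))) = M as g" using Cons.prems(1) by (intro M_cong) auto
    then show ?thesis unfolding True by (simp only: M.simps fun_upd_same funpow.simps comp_apply)
  next
    case False
    then show ?thesis using Cons by (simp add: f_pow M_in_V subset_iff)
  qed
qed simp

definition K :: "('i \<Rightarrow> nat) set" where
  "K = (\<Pi>\<^sub>E a\<in>J. {..dd a})"

context
  fixes as :: "'i list"
  assumes as: "distinct as" "set as = J"
begin

lemma M_K_nonzero: "g \<in> K \<Longrightarrow> M as g \<noteq> 0"
  using as by (intro M_nonzero) (auto simp: K_def)

lemma M_K_weight: "b \<in> J \<Longrightarrow> ap (h b) (M as g) = (of_nat (dd b) - 2 * of_nat (g b)) *f M as g"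
  using as by (simp add: M_h \<mu>_eq)

lemma K_neq: assumes "g \<in> K" "g' \<in> K" "g \<noteq> g'" shows "\<exists>b\<in>J. g b \<noteq> g' b"
  using PiE_ext[OF assms(1,2)[unfolded K_def]] assms(3) by auto

lemma M_inj: "inj_on (M as) K"
proof (rule inj_onI, rule ccontr)
  fix g g' assume g: "g \<in> K" "g' \<in> K" and eq: "M as g = M as g'" and "g \<noteq> g'"
  then obtain b where b: "b \<in> J" "g b \<noteq> g' b" using K_neq by blast
  have "(of_nat (dd b) - 2 * of_nat (g b)) *f M as g = (of_nat (dd b) - 2 * of_nat (g' b)) *f M as g"
    unfolding M_K_weight[OF b(1), symmetric] unfolding eq by (rule M_K_weight[OF b(1)])
  then have "of_nat (dd b) - 2 * of_nat (g b) = (of_nat (dd b) - 2 * of_nat (g' b) :: 'a)"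
    using M_K_nonzero[OF g(1)] fs.scale_cancel_right by blast
  then show False using b(2) by simp
qed

lemma M_independent: "fs.independent (M as ` K)"
  unfolding fs.dependent_def
proof
  assume "\<exists>w\<in>M as ` K. w \<in> fs.span (M as ` K - {w})"
  then obtain g where g: "g \<in> K" "M as g \<in> fs.span (M as ` K - {M as g})" by blast
  have "M as g = 0"
  proof (rule joint_eigenvectors_independent[where h = h and J = J and \<theta> = "\<lambda>b. of_nat (dd b) - 2 * of_nat (g b)"])
    show "M as g \<in> fs.span (M as ` K - {M as g})" by (rule g)
    fix w assume "w \<in> M as ` K - {M as g}"
    then obtain g' where g': "g' \<in> K" "w = M as g'" "g' \<noteq> g" by blast
    then obtain b where "b \<in> J" "g' b \<noteq> g b" using K_neq g(1) by blast
    then show "\<exists>j\<in>J. \<exists>c. ap (h j) w = c *f w \<and> c \<noteq> of_nat (dd j) - 2 * of_nat (g j)"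
      using g'(2) M_K_weight[of b g'] by (intro bexI[of _ b] exI[of _ "of_nat (dd b) - 2 * of_nat (g' b)"]) simp_all
    show "\<exists>c. ap (h j) w = c *f w" if "j \<in> J" for j
      using g'(2) M_K_weight[OF that] by blast
  qed (rule M_K_weight)
  then show False using M_K_nonzero[OF g(1)] by simp
qed

lemma v_in_span: "v \<in> fs.span (M as ` K)"
proof -
  let ?g = "restrict (\<lambda>_. 0) J"
  have "M bs ?g = v" if "set bs \<subseteq> J" for bs using that by (induction bs) simp_all
  then have "M as ?g = v" using as(2) by simp
  moreover have "?g \<in> K" by (auto simp: K_def)
  then have "M as ?g \<in> fs.span (M as ` K)" by (intro fs.span_base imageI)
  ultimately show ?thesis by simp
qed

lemma f_span: assumes "b \<in> J" "w \<in> fs.span (M as ` K)" shows "ap (f b) w \<in> fs.span (M as ` K)"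
  using assms(2)
proof (induction rule: fs.span_induct_alt)
  case (step c w w')
  obtain g where g: "g \<in> K" "w = M as g" using step(1) by blast
  have "ap (f b) w = M as (g(b := Suc (g b)))"
    using g(2) f_M[of as b g] as assms(1) by simp
  also have "\<dots> \<in> fs.span (M as ` K)"
  proof (cases "g b < dd b")
    case True
    then have "g(b := Suc (g b)) \<in> K" using g(1) assms(1) by (auto simp: K_def PiE_iff extensional_def)
    then show ?thesis by (intro fs.span_base imageI)
  next
    case False
    then show ?thesis using M_zero[of as b "g(b := Suc (g b))"] as assms(1) by (simp add: fs.span_zero)
  qed
  finally show ?case using step(2) by (simp add: fs.span_add fs.span_scale)
qed (simp add: fs.span_zero)

end

end

section \<open>Highest weight modules of the Onsager algebra\<close>

lemma ap_lie: "ap (lie S T) w = ap S (ap T w) - ap T (ap S w)"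
  by (simp add: lie_def)

lemma ap_lie_commute: "ap S (ap T w) = ap T (ap S w) + ap (lie S T) w"
  by (simp add: ap_lie)

lemma preserves_span:
  assumes "\<And>w. w \<in> E \<Longrightarrow> ap T w \<in> fs.span E"
  shows "preserves (fs.span E) T"
proof -
  have "ap T w \<in> fs.span E" if "w \<in> fs.span E" for w
    using that
    by (induction rule: fs.span_induct_alt) (simp_all add: fs.span_zero fs.span_add fs.span_scale assms)
  then show ?thesis by (simp add: preserves_def)
qed

inductive_set words :: "(nat \<Rightarrow> 'a::field lin) \<Rightarrow> (nat \<Rightarrow> 'a) set \<Rightarrow> (nat \<Rightarrow> 'a) set"
  for y :: "nat \<Rightarrow> 'a lin" and S :: "(nat \<Rightarrow> 'a) set" where
  base: "s \<in> S \<Longrightarrow> s \<in> words y S"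
| step: "w \<in> words y S \<Longrightarrow> ap (y k) w \<in> words y S"

lemma words_subset_subspace:
  assumes "S \<subseteq> U" "\<And>k. preserves U (y k)"
  shows "words y S \<subseteq> U"
proof
  fix w assume "w \<in> words y S"
  then show "w \<in> U" by induction (use assms(1) preservesD[OF assms(2)] in auto)
qed

text \<open>The polynomial \<open>(u\<^sup>2 - 4) / 2\<close>: bracketing with \<open>Q(r)\<close> turns \<open>Y(q)\<close> into \<open>Y(\<kappa> r q)\<close>.\<close>

definition \<kappa> :: "'a::field_char_0 poly" where
  "\<kappa> = [:-2, 0, 1/2:]"

locale highest_weight =
  fixes V :: "(nat \<Rightarrow> 'a::field_char_0) set" and B :: "(nat \<Rightarrow> 'a) set"
    and A Z :: "'a lin" and x y Q :: "nat \<Rightarrow> 'a lin" and \<theta> :: 'a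
  assumes closed: "alg_closed_field TYPE('a)"
    and V: "fs.subspace V" and B: "finite B" "V \<subseteq> fs.span B"
    and pres_A: "preserves V A" and pres_Z: "preserves V Z"
    and pres_x: "preserves V (x k)" and pres_y: "preserves V (y k)" and pres_Q: "preserves V (Q k)"
    and A_y: "lie A (y k) = sc (- 2) * y k" and A_Z: "lie A Z = 0" and A_Q: "lie A (Q k) = 0"
    and x_y: "lie (x i) (y j) = Q (i + j)" and y_y: "lie (y i) (y j) = 0"
    and Z_y: "lie Z (y i) = - y (Suc i)" and Z_Q: "lie Z (Q i) = 0"
    and Q_y: "lie (Q i) (y j) = sc (1/2) * y (i + j + 2) + sc (- 2) * y (i + j)"
    and Q_Q: "lie (Q i) (Q j) = 0"
    and irreducible: "fs.subspace W \<Longrightarrow> W \<subseteq> V \<Longrightarrow> preserves W A \<Longrightarrow> preserves W Z \<Longrightarrow>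
      preserves W (x 0) \<Longrightarrow> preserves W (y 0) \<Longrightarrow> W = {0} \<or> W = V"
    and top: "w \<in> V \<Longrightarrow> ap A w = \<theta> *f w \<Longrightarrow> ap (x k) w = 0"
    and top_nonzero: "\<exists>w\<in>V. w \<noteq> 0 \<and> ap A w = \<theta> *f w"
    and bottom: "\<exists>N. \<forall>w\<in>V. ap A w = (\<theta> - 2 * of_nat N) *f w \<longrightarrow> w = 0"
begin

lemma generated_submodule:
  assumes S: "fs.subspace S" "S \<subseteq> V" "preserves S A" "preserves S Z" "\<And>k. preserves S (Q k)"
    and xS: "\<And>k s. s \<in> S \<Longrightarrow> ap (x k) s = 0"
  shows "fs.span (words y S) = {0} \<or> fs.span (words y S) = V"
proof -
  let ?U = "fs.span (words y S)"
  have base: "w \<in> ?U" if "w \<in> words y S" for w using that by (rule fs.span_base)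
  have S_U: "w \<in> ?U" if "w \<in> S" for w using that by (intro base words.base)
  have pres_y': "preserves ?U (y k)" for k
    by (rule preserves_span) (intro base words.step)
  have Q_words: "ap (Q i) w \<in> ?U" if "w \<in> words y S" for w i
    using that
  proof induction
    case (base s)
    then show ?case using preservesD[OF S(5)] S_U by simp
  next
    case (step w k)
    have "ap (Q i) (ap (y k) w) = ap (y k) (ap (Q i) w) + ((1/2) *f ap (y (i + k + 2)) w + (- 2) *f ap (y (i + k)) w)"
      by (subst ap_lie_commute) (simp add: Q_y)
    moreover have "ap (y j) w \<in> ?U" for j using step(1) by (intro base words.step)
    ultimately show ?case
      using preservesD[OF pres_y' step.IH] by (simp only: fs.span_add fs.span_scale)
  qed
  have A_words: "ap A w \<in> ?U" if "w \<in> words y S" for w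
    using that
  proof induction
    case (base s)
    then show ?case using preservesD[OF S(3)] S_U by simp
  next
    case (step w k)
    have "ap A (ap (y k) w) = ap (y k) (ap A w) + (- 2) *f ap (y k) w"
      by (subst ap_lie_commute) (simp add: A_y)
    moreover have "ap (y k) w \<in> ?U" using step(1) by (intro base words.step)
    ultimately show ?case
      using preservesD[OF pres_y' step.IH] by (simp only: fs.span_add fs.span_scale)
  qed
  have Z_words: "ap Z w \<in> ?U" if "w \<in> words y S" for w
    using that
  proof induction
    case (base s)
    then show ?case using preservesD[OF S(4)] S_U by simp
  next
    case (step w k)
    have "ap Z (ap (y k) w) = ap (y k) (ap Z w) - ap (y (Suc k)) w"
      by (subst ap_lie_commute) (simp add: Z_y)
    moreover have "ap (y (Suc k)) w \<in> ?U" using step(1) by (intro base words.step)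
    ultimately show ?case
      using preservesD[OF pres_y' step.IH] by (simp only: fs.span_diff)
  qed
  have x_words: "ap (x i) w \<in> ?U" if "w \<in> words y S" for w i
    using that
  proof induction
    case (base s)
    then show ?case using xS by (simp add: fs.span_zero)
  next
    case (step w k)
    have "ap (x i) (ap (y k) w) = ap (y k) (ap (x i) w) + ap (Q (i + k)) w"
      by (subst ap_lie_commute) (simp add: x_y)
    then show ?case
      using preservesD[OF pres_y' step.IH] Q_words[OF step(1)] by (simp only: fs.span_add)
  qed
  show ?thesis
  proof (rule irreducible)
    show "?U \<subseteq> V" by (rule fs.span_minimal[OF words_subset_subspace[OF S(2) pres_y] V])
  qed (simp_all add: preserves_span A_words Z_words x_words pres_y')
qed

lemma top_vector: "\<exists>v lam z. v \<in> V \<and> v \<noteq> 0 \<and> ap A v = \<theta> *f v \<and> ap Z v = z *f v \<and> (\<forall>k. ap (Q k) v = lam k *f v)"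
proof -
  let ?U = "{w \<in> V. ap A w = \<theta> *f w}"
  have comm: "ap S (ap T w) = ap T (ap S w)" if "lie S T = 0" for S T :: "'a lin" and w
    using ap_lie_commute[of S T w] that by simp
  have sub: "fs.subspace ?U"
    using V by (auto simp: fs.subspace_def fs.scale_right_distrib mult.commute)
  have "\<exists>v\<in>?U. v \<noteq> 0 \<and> (\<forall>T\<in>insert Z (range Q). \<exists>c. ap T v = c *f v)"
  proof (rule common_eigenvector[OF closed B(1) sub])
    show "?U \<subseteq> fs.span B" using B(2) by blast
    show "?U \<noteq> {0}" using top_nonzero by blast
    fix S assume S: "S \<in> insert Z (range Q)"
    then have AS: "lie A S = 0" using A_Z A_Q by auto
    moreover have "preserves V S" using S pres_Z pres_Q by auto
    ultimately show "preserves ?U S" by (simp add: preserves_def comm[OF AS])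
    fix T u assume T: "T \<in> insert Z (range Q)" and "u \<in> ?U"
    have "lie (Q i) Z = 0" for i using Z_Q[of i] lie_swap[of "Q i" Z] by simp
    then have "lie S T = 0" using S T Z_Q Q_Q by auto
    then show "ap S (ap T u) = ap T (ap S u)" by (rule comm)
  qed
  then obtain v where v: "v \<in> ?U" "v \<noteq> 0" "\<forall>T\<in>insert Z (range Q). \<exists>c. ap T v = c *f v" by (elim bexE conjE)
  have "\<exists>z. ap Z v = z *f v" using v(3) by blast
  moreover have "\<forall>k. \<exists>c. ap (Q k) v = c *f v" using v(3) by blast
  then have "\<exists>lam. \<forall>k. ap (Q k) v = lam k *f v" by (rule choice)
  ultimately show ?thesis using v(1,2) by auto
qed

end

locale highest_weight_vector = highest_weight V B A Z x y Q \<theta>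
  for V :: "(nat \<Rightarrow> 'a::field_char_0) set" and B A Z x y Q \<theta> +
  fixes v :: "nat \<Rightarrow> 'a" and lam :: "nat \<Rightarrow> 'a" and z :: 'a
  assumes v: "v \<in> V" "v \<noteq> 0"
    and A_v: "ap A v = \<theta> *f v" and Z_v: "ap Z v = z *f v" and Q_v: "ap (Q k) v = lam k *f v"
begin

abbreviation "Xp \<equiv> poly_comb x"
abbreviation "Yp \<equiv> poly_comb y"
abbreviation "Qp \<equiv> poly_comb Q"

definition Lam :: "'a poly \<Rightarrow> 'a" where
  "Lam p = (\<Sum>i\<le>degree p. coeff p i * lam i)"

lemma Qp_v: "ap (Qp p) v = Lam p *f v"
  by (simp add: poly_comb_def Lam_def ap_sum Q_v fs.scale_sum_left mult.commute)

lemma lie_X_Y: "lie (Xp p) (Yp q) = Qp (p * q)"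
  by (rule lie_poly_comb_convolve) (rule x_y)

lemma lie_Y_Y: "lie (Yp p) (Yp q) = 0"
  by (simp add: lie_poly_comb y_y) (simp add: poly_comb_def)

lemma Y_commute: "ap (Yp p) (ap (Yp q) w) = ap (Yp q) (ap (Yp p) w)"
  by (subst ap_lie_commute) (simp add: lie_Y_Y)

lemma lie_A_Y: "lie A (Yp q) = sc (- 2) * Yp q"
  by (simp only: lie_poly_comb A_y poly_comb_linear_seq)

lemma lie_Z_Y: "lie Z (Yp q) = - Yp (pCons 0 q)"
  by (simp only: lie_poly_comb Z_y poly_comb_linear_seq poly_comb_shift)

lemma lie_Q_Y: "lie (Qp r) (Yp q) = Yp (\<kappa> * r * q)"
proof -
  define g where "g n = sc (1/2) * y (n + 2) + sc (- 2) * y n" for n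
  have "lie (Qp r) (Yp q) = poly_comb g (r * q)"
    by (rule lie_poly_comb_convolve) (simp add: g_def Q_y add_ac)
  also have "\<dots> = Yp (\<kappa> * (r * q))"
    unfolding g_def[abs_def] poly_comb_linear_seq
    by (simp add: \<kappa>_def poly_comb_add poly_comb_smult poly_comb_diff poly_comb_shift sc_minus)
  finally show ?thesis by (simp add: mult.assoc)
qed

lemma pres_Xp: "preserves V (Xp p)" and pres_Yp: "preserves V (Yp p)" and pres_Qp: "preserves V (Qp p)"
  by (intro preserves_poly_comb V pres_x pres_y pres_Q)+

lemma X_v: "ap (Xp p) v = 0"
  by (simp add: poly_comb_def ap_sum top[OF v(1) A_v])

lemma cyclic: "V = fs.span (words y (fs.span {v}))"
proof -
  have S: "fs.span {v} \<subseteq> V" using fs.span_minimal[OF _ V] v(1) by simp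
  have eig: "preserves (fs.span {v}) T" if "ap T v = c *f v" for T c
    by (rule preserves_span) (simp add: that fs.span_base fs.span_scale)
  have "v \<in> fs.span (words y (fs.span {v}))"
    by (intro fs.span_base words.base) simp
  moreover have "fs.span (words y (fs.span {v})) = {0} \<or> fs.span (words y (fs.span {v})) = V"
  proof (rule generated_submodule[OF fs.subspace_span S eig[OF A_v] eig[OF Z_v] eig[OF Q_v]])
    fix k s assume "s \<in> fs.span {v}"
    then obtain c where "s = c *f v" by (auto simp: fs.span_singleton)
    then show "ap (x k) s = 0" using top[OF v(1) A_v] by simp
  qed
  ultimately show ?thesis using v(2) by auto
qed

definition I :: "'a poly set" where
  "I = {q. \<forall>p. Lam (p * q) = 0}"

lemma I_mult: "q \<in> I \<Longrightarrow> p * q \<in> I"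
  by (simp add: I_def mult.assoc[symmetric])

lemma I_dvd: "q \<in> I \<Longrightarrow> q dvd p \<Longrightarrow> p \<in> I"
  using I_mult[of q] by (auto elim!: dvdE simp: mult.commute)

lemma Yp_weight: "ap A w = c *f w \<Longrightarrow> ap A (ap (Yp p) w) = (c - 2) *f ap (Yp p) w"
  by (subst ap_lie_commute) (simp add: lie_A_Y fs.scale_left_diff_distrib)

lemma Y_I_v:
  assumes q: "q \<in> I"
  shows "ap (Yp q) v = 0"
proof -
  let ?S = "range (\<lambda>p. ap (Yp (p * q)) v)"
  have S: "fs.subspace ?S"
    unfolding fs.subspace_def
  proof (intro conjI ballI allI)
    show "0 \<in> ?S" by (rule range_eqI[of _ _ 0]) simp
    fix s t assume "s \<in> ?S" "t \<in> ?S"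
    then obtain p r where "s = ap (Yp (p * q)) v" "t = ap (Yp (r * q)) v" by blast
    then show "s + t \<in> ?S" by (intro range_eqI[of _ _ "p + r"]) (simp add: distrib_right poly_comb_add)
  next
    fix c s assume "s \<in> ?S"
    then obtain p where "s = ap (Yp (p * q)) v" by blast
    then show "c *f s \<in> ?S" by (intro range_eqI[of _ _ "smult c p"]) (simp add: poly_comb_smult)
  qed
  have S_V: "?S \<subseteq> V" using preservesD[OF pres_Yp v(1)] by auto
  have S_A: "ap A s = (\<theta> - 2) *f s" if "s \<in> ?S" for s using that Yp_weight[OF A_v] by blast
  have alt: "fs.span (words y ?S) = {0} \<or> fs.span (words y ?S) = V"
  proof (rule generated_submodule[OF S S_V])
    show "preserves ?S A" using S_A fs.subspace_scale[OF S] by (auto simp: preserves_def)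
    show "preserves ?S Z"
      unfolding preserves_def
    proof
      fix s assume "s \<in> ?S"
      then obtain p where s: "s = ap (Yp (p * q)) v" by blast
      have "ap Z s = z *f s - ap (Yp (pCons 0 p * q)) v"
        unfolding s by (subst ap_lie_commute) (simp add: lie_Z_Y Z_v)
      then show "ap Z s \<in> ?S"
        using \<open>s \<in> ?S\<close> by (simp only:) (intro fs.subspace_diff[OF S] fs.subspace_scale[OF S] rangeI)
    qed
    show "preserves ?S (Q k)" for k
      unfolding preserves_def
    proof
      fix s assume "s \<in> ?S"
      then obtain p where s: "s = ap (Yp (p * q)) v" by blast
      have Qk: "Q k = Qp (monom 1 k)" by (simp add: poly_comb_monom)
      have "ap (Q k) s = lam k *f s + ap (Yp ((\<kappa> * monom 1 k * p) * q)) v"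
        unfolding s by (subst ap_lie_commute, simp add: Q_v) (simp add: Qk lie_Q_Y mult.assoc)
      then show "ap (Q k) s \<in> ?S"
        using \<open>s \<in> ?S\<close> by (simp only:) (intro fs.subspace_add[OF S] fs.subspace_scale[OF S] rangeI)
    qed
    fix k s assume "s \<in> ?S"
    then obtain p where s: "s = ap (Yp (p * q)) v" by blast
    have xk: "x k = Xp (monom 1 k)" by (simp add: poly_comb_monom)
    have "ap (x k) s = ap (Yp (p * q)) (ap (x k) v) + ap (Qp (monom 1 k * (p * q))) v"
      unfolding s xk by (subst ap_lie_commute) (simp only: lie_X_Y)
    then show "ap (x k) s = 0"
      using q by (simp add: Qp_v I_def top[OF v(1) A_v] mult.assoc[symmetric])
  qed
  have eig: "\<exists>k. ap A w = (\<theta> - 2 * of_nat (Suc k)) *f w" if "w \<in> words y ?S" for w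
    using that
  proof induction
    case (base s)
    then show ?case using S_A by (intro exI[of _ 0]) simp
  next
    case (step w j)
    then obtain k where "ap A w = (\<theta> - 2 * of_nat (Suc k)) *f w" by blast
    from Yp_weight[OF this, of "monom 1 j"]
    have "ap A (ap (y j) w) = (\<theta> - 2 * of_nat (Suc k) - 2) *f ap (y j) w" by (simp add: poly_comb_monom)
    then show ?case by (intro exI[of _ "Suc k"]) (simp add: algebra_simps)
  qed
  have "v \<notin> fs.span (words y ?S)"
  proof
    assume span: "v \<in> fs.span (words y ?S)"
    have "v = 0"
    proof (rule joint_eigenvectors_independent[where h = "\<lambda>_. A" and J = "{()}" and \<theta> = "\<lambda>_. \<theta>", OF _ _ span A_v])
      fix w assume "w \<in> words y ?S"
      then obtain k where k: "ap A w = (\<theta> - 2 * of_nat (Suc k)) *f w" using eig by blast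
      then show "\<exists>c. ap A w = c *f w" for j :: unit by blast
      show "\<exists>j\<in>{()}. \<exists>c. ap A w = c *f w \<and> c \<noteq> \<theta>"
        using k by (intro bexI[of _ "()"] exI[of _ "\<theta> - 2 * of_nat (Suc k)"]) (simp_all del: of_nat_Suc)
    qed
    then show False using v(2) by simp
  qed
  then have "fs.span (words y ?S) = {0}" using alt v(1) by auto
  moreover have "ap (Yp (1 * q)) v \<in> fs.span (words y ?S)"
    by (intro fs.span_base words.base rangeI)
  ultimately show ?thesis by simp
qed

lemma Y_I:
  assumes q: "q \<in> I" and w: "w \<in> V"
  shows "ap (Yp q) w = 0"
proof -
  have "ap (Yp q) w = 0" if "w \<in> words y (fs.span {v})" for w
    using that
  proof induction
    case (base s)
    then obtain c where "s = c *f v" by (auto simp: fs.span_singleton)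
    then show ?case using Y_I_v[OF q] by simp
  next
    case (step w k)
    then show ?case using Y_commute[of q "monom 1 k" w] by (simp add: poly_comb_monom)
  qed
  note words = this
  have "w \<in> fs.span (words y (fs.span {v}))" using w cyclic by simp
  then show ?thesis
    by (induction rule: fs.span_induct_alt) (simp_all add: words)
qed

lemma I_iff: "q \<in> I \<longleftrightarrow> ap (Yp q) v = 0"
proof
  assume "ap (Yp q) v = 0"
  then have "ap (Qp (p * q)) v = 0" for p
    using ap_lie[of "Xp p" "Yp q" v] by (simp add: lie_X_Y X_v)
  then show "q \<in> I" using v(2) by (simp add: I_def Qp_v fs.scale_eq_0_iff)
qed (rule Y_I_v)

lemma Q_I: "q \<in> I \<Longrightarrow> w \<in> V \<Longrightarrow> ap (Qp q) w = 0"
  using ap_lie[of "Xp 1" "Yp q" w] by (simp add: lie_X_Y Y_I preservesD[OF pres_Xp])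

lemma I_nontrivial: "\<exists>q\<in>I. q \<noteq> 0"
proof -
  have "ap (y k) v \<in> fs.span B" for k using preservesD[OF pres_y v(1)] B(2) by blast
  then show ?thesis using poly_comb_annihilates[OF B(1)] I_iff by blast
qed

lemma pow_weight:
  assumes "ap A w = c *f w"
  shows "ap A ((ap (Yp p) ^^ k) w) = (c - 2 * of_nat k) *f (ap (Yp p) ^^ k) w"
proof (induction k)
  case (Suc k)
  then show ?case using Yp_weight[OF Suc, of p] by (simp add: algebra_simps)
qed (simp add: assms)

lemma pow_in_V: "(ap (Yp p) ^^ k) v \<in> V"
  by (induction k) (simp_all add: v preservesD[OF pres_Yp])

lemma Y_nilpotent: "\<exists>k. (ap (Yp p) ^^ k) v = 0"
proof -
  obtain N where "\<forall>w\<in>V. ap A w = (\<theta> - 2 * of_nat N) *f w \<longrightarrow> w = 0"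
    using bottom by (elim exE)
  then show ?thesis using pow_weight[OF A_v] pow_in_V by blast
qed

text \<open>If \<open>p \<notin> I\<close>, choose \<open>q\<close> with \<open>\<Lambda>(q p) \<noteq> 0\<close>: then \<open>X(q)\<close> maps \<open>Y(p)\<^sup>k\<^sup>+\<^sup>1 v\<close> to a nonzero multiple of
  \<open>Y(p)\<^sup>k v\<close>, which contradicts the nilpotency of \<open>Y(p)\<close>.\<close>

lemma I_radical:
  assumes "p * p * \<kappa> \<in> I"
  shows "p \<in> I"
proof (rule ccontr)
  assume "p \<notin> I"
  then obtain q where q: "Lam (q * p) \<noteq> 0" by (auto simp: I_def)
  let ?w = "\<lambda>k. (ap (Yp p) ^^ k) v"
  have Q: "ap (Qp (q * p)) (?w k) = Lam (q * p) *f ?w k" for k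
  proof (induction k)
    case (Suc k)
    have "\<kappa> * (q * p) * p \<in> I" using I_mult[OF assms, of q] by (simp add: mult_ac)
    then have "ap (Qp (q * p)) (ap (Yp p) (?w k)) = ap (Yp p) (ap (Qp (q * p)) (?w k))"
      by (subst ap_lie_commute) (simp add: lie_Q_Y Y_I pow_in_V)
    then show ?case using Suc by simp
  qed (simp add: Qp_v)
  have X: "ap (Xp q) (?w (Suc k)) = (of_nat (Suc k) * Lam (q * p)) *f ?w k" for k
  proof (induction k)
    case 0
    have "ap (Xp q) (ap (Yp p) v) = ap (Yp p) (ap (Xp q) v) + ap (Qp (q * p)) v"
      by (subst ap_lie_commute) (simp only: lie_X_Y)
    then show ?case by (simp add: X_v Qp_v)
  next
    case (Suc k)
    have "ap (Xp q) (ap (Yp p) (?w (Suc k))) = ap (Yp p) (ap (Xp q) (?w (Suc k))) + ap (Qp (q * p)) (?w (Suc k))"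
      by (subst ap_lie_commute) (simp only: lie_X_Y)
    also have "\<dots> = (of_nat (Suc k) * Lam (q * p)) *f ?w (Suc k) + Lam (q * p) *f ?w (Suc k)"
      unfolding Suc Q by simp
    also have "\<dots> = (of_nat (Suc k) * Lam (q * p) + Lam (q * p)) *f ?w (Suc k)"
      by (rule fs.scale_left_distrib[symmetric])
    also have "of_nat (Suc k) * Lam (q * p) + Lam (q * p) = of_nat (Suc (Suc k)) * Lam (q * p)"
      by (simp add: algebra_simps)
    finally show ?case by simp
  qed
  have "?w k \<noteq> 0" for k
  proof (induction k)
    case (Suc k)
    show ?case
    proof
      assume "?w (Suc k) = 0"
      then have "(of_nat (Suc k) * Lam (q * p)) *f ?w k = 0" using X[of k] by (simp only: ap_zero_right)
      then have "of_nat (Suc k) * Lam (q * p) = 0" using Suc by (simp only: fs.scale_eq_0_iff) blast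
      then show False using q by (simp del: of_nat_Suc)
    qed
  qed (simp add: v)
  then show False using Y_nilpotent[of p] by blast
qed

end

lemma prod_linear_dvd:
  assumes "finite J" "\<And>a. a \<in> J \<Longrightarrow> poly p a = (0::'a::field)"
  shows "(\<Prod>a\<in>J. [:- a, 1:]) dvd p"
  using assms
proof (induction J arbitrary: p rule: finite_induct)
  case (insert b J)
  have "(\<Prod>a\<in>J. [:- a, 1:]) dvd p" by (intro insert.IH insert.prems) simp
  then obtain q where q: "p = (\<Prod>a\<in>J. [:- a, 1:]) * q" by (elim dvdE)
  have "poly (\<Prod>a\<in>J. [:- a, 1:]) b \<noteq> 0"
    using insert.hyps by (auto simp: poly_prod)
  moreover have "poly p b = 0" using insert.prems by simp
  ultimately have "poly q b = 0" by (simp add: q)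
  then obtain r where r: "q = [:- b, 1:] * r" unfolding poly_eq_0_iff_dvd by (elim dvdE)
  have "p = (\<Prod>a\<in>insert b J. [:- a, 1:]) * r"
    unfolding q r prod.insert[OF insert.hyps] by (simp only: mult_ac)
  then show ?case by simp
qed simp

lemma dvd_power_prod_roots:
  assumes closed: "alg_closed_field TYPE('a::field)" and "(p :: 'a poly) \<noteq> 0"
  shows "\<exists>N. p dvd (\<Prod>a\<in>{a. poly p a = 0}. [:- a, 1:]) ^ N"
  using assms(2)
proof (induction "degree p" arbitrary: p rule: less_induct)
  case less
  let ?R = "\<lambda>p :: 'a poly. \<Prod>a\<in>{a. poly p a = 0}. [:- a, 1:]"
  show ?case
  proof (cases "degree p = 0")
    case True
    then have "p dvd 1" using less.prems by (auto simp: is_unit_iff_degree)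
    then show ?thesis by (intro exI[of _ 0]) simp
  next
    case False
    then obtain b where b: "poly p b = 0" using closed by (auto simp: alg_closed_field_def)
    then obtain q where q: "p = [:- b, 1:] * q" unfolding poly_eq_0_iff_dvd by (elim dvdE)
    then have "q \<noteq> 0" using less.prems by auto
    then have "degree q < degree p" unfolding q by (subst degree_mult_eq) auto
    then obtain N where N: "q dvd ?R q ^ N" using less.hyps \<open>q \<noteq> 0\<close> by blast
    have fin: "finite {a. poly p a = 0}" using less.prems by (rule poly_roots_finite)
    have "?R q dvd ?R p"
      by (rule prod_dvd_prod_subset[OF fin]) (auto simp: q)
    then have "q dvd ?R p ^ N" by (rule dvd_trans[OF N dvd_power_same])
    moreover have "[:- b, 1:] dvd ?R p" by (rule dvd_prodI[OF fin]) (simp add: b)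
    ultimately have "p dvd ?R p * ?R p ^ N" unfolding q by (intro mult_dvd_mono)
    then show ?thesis by (intro exI[of _ "Suc N"]) simp
  qed
qed

definition lagrange :: "'a::field set \<Rightarrow> 'a \<Rightarrow> 'a poly" where
  "lagrange J a = (\<Prod>b\<in>J - {a}. smult (1 / (a - b)) [:- b, 1:])"

lemma poly_lagrange:
  assumes "finite J" "a \<in> J" "c \<in> J"
  shows "poly (lagrange J a) c = (if c = a then 1 else 0)"
proof (cases "c = a")
  case True
  have "poly (smult (1 / (a - b)) [:- b, 1:]) a = 1" if "b \<in> J - {a}" for b
    using that by (auto simp: diff_divide_distrib[symmetric])
  then show ?thesis using True by (simp add: lagrange_def poly_prod del: poly_smult poly_pCons)
next
  case False
  then have "c \<in> J - {a}" using assms by simp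
  then show ?thesis using False assms(1) by (auto simp: lagrange_def poly_prod)
qed

context highest_weight_vector
begin

lemma I_separable: "\<exists>J. finite J \<and> 2 \<notin> J \<and> - 2 \<notin> J \<and> (\<Prod>a\<in>J. [:- a, 1:]) \<in> I"
proof -
  obtain m where m: "m \<in> I" "m \<noteq> 0" using I_nontrivial by blast
  define R where "R = (\<Prod>a\<in>{a. poly m a = 0}. [:- a, 1:])"
  obtain N where N: "m dvd R ^ N"
    using dvd_power_prod_roots[OF closed m(2)] unfolding R_def by blast
  define J where "J = {a. poly m a = 0} - {2, - 2}"
  define r where "r = (\<Prod>a\<in>J. [:- a, 1:])"
  have fin: "finite J" using poly_roots_finite[OF m(2)] by (simp add: J_def)
  have "R dvd r * \<kappa>"
    unfolding R_def
  proof (rule prod_linear_dvd)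
    show "poly (r * \<kappa>) a = 0" if "a \<in> {a. poly m a = 0}" for a
    proof (cases "a \<in> J")
      case True
      then show ?thesis using fin by (auto simp: r_def poly_prod)
    next
      case False
      then have "a = 2 \<or> a = - 2" using that by (simp add: J_def)
      then show ?thesis by (auto simp: \<kappa>_def)
    qed
  qed (use poly_roots_finite[OF m(2)] in simp)
  then have "m dvd (r * \<kappa>) ^ N" by (rule dvd_trans[OF N dvd_power_same])
  then have "m dvd (r * \<kappa>) ^ (2 ^ N)"
    by (rule dvd_trans) (simp add: le_imp_power_dvd)
  then have "(r * \<kappa>) ^ (2 ^ N) \<in> I" by (rule I_dvd[OF m(1)])
  then have "r * \<kappa> \<in> I"
  proof (induction N)
    case (Suc N)
    have eq: "(r * \<kappa>) ^ (2 ^ Suc N) = (r * \<kappa>) ^ (2 ^ N) * (r * \<kappa>) ^ (2 ^ N)"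
      by (simp only: power_Suc mult_2 power_add)
    have "(r * \<kappa>) ^ (2 ^ N) * (r * \<kappa>) ^ (2 ^ N) * \<kappa> \<in> I"
      by (rule I_dvd[OF Suc.prems]) (unfold eq, rule dvd_triv_left)
    then show ?case by (rule Suc.IH[OF I_radical])
  qed simp
  then have "r * r * \<kappa> \<in> I" by (rule I_dvd) (simp add: mult.assoc)
  then have "r \<in> I" by (rule I_radical)
  then show ?thesis using fin unfolding r_def by (intro exI[of _ J]) (simp add: J_def)
qed

lemma weight_basis:
  "\<exists>(J :: 'a set) dd F. finite J \<and> inj_on F (\<Pi>\<^sub>E a\<in>J. {..dd a}) \<and>
    fs.independent (F ` (\<Pi>\<^sub>E a\<in>J. {..dd a :: nat})) \<and> fs.span (F ` (\<Pi>\<^sub>E a\<in>J. {..dd a})) = V \<and>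
    (\<forall>g \<in> \<Pi>\<^sub>E a\<in>J. {..dd a}. ap A (F g) = (\<theta> - 2 * of_nat (\<Sum>a\<in>J. g a)) *f F g)"
proof -
  obtain J where J: "finite J" "2 \<notin> J" "- 2 \<notin> J" "(\<Prod>a\<in>J. [:- a, 1:]) \<in> I"
    using I_separable by blast
  have vanish: "q \<in> I" if "\<And>a. a \<in> J \<Longrightarrow> poly q a = 0" for q
    by (rule I_dvd[OF J(4) prod_linear_dvd[OF J(1) that]])
  have Y_eq: "ap (Yp p) w = ap (Yp q) w" if "\<And>a. a \<in> J \<Longrightarrow> poly p a = poly q a" "w \<in> V" for p q w
  proof -
    have "p - q \<in> I" using that(1) by (intro vanish) simp
    then show ?thesis using Y_I[OF _ that(2), of "p - q"] by (simp add: poly_comb_diff)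
  qed
  have Q_eq: "ap (Qp p) w = ap (Qp q) w" if "\<And>a. a \<in> J \<Longrightarrow> poly p a = poly q a" "w \<in> V" for p q w
  proof -
    have "p - q \<in> I" using that(1) by (intro vanish) simp
    then show ?thesis using Q_I[OF _ that(2), of "p - q"] by (simp add: poly_comb_diff)
  qed
  define \<epsilon> where "\<epsilon> = lagrange J"
  define \<rho> where "\<rho> a = smult (- 2 / poly \<kappa> a) (\<epsilon> a)" for a
  have \<kappa>: "poly \<kappa> a \<noteq> 0" if "a \<in> J" for a
  proof
    assume "poly \<kappa> a = 0"
    then have "(a - 2) * (a + 2) = 0" by (simp add: \<kappa>_def algebra_simps)
    then have "a = 2 \<or> a = - 2" by (simp add: eq_neg_iff_add_eq_0)
    then show False using that J(2,3) by blast
  qed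
  have \<epsilon>: "poly (\<epsilon> a) c = (if c = a then 1 else 0)" if "a \<in> J" "c \<in> J" for a c
    unfolding \<epsilon>_def by (rule poly_lagrange[OF J(1) that])
  interpret sl: commuting_sl2 V J "\<lambda>a. Xp (\<rho> a)" "\<lambda>a. Yp (\<epsilon> a)" "\<lambda>a. Qp (\<rho> a)" v "\<lambda>a. Lam (\<rho> a)"
  proof
    fix a b w assume ab: "a \<in> J" "b \<in> J" and w: "w \<in> V"
    show "ap (Yp (\<epsilon> a)) (ap (Yp (\<epsilon> b)) w) = ap (Yp (\<epsilon> b)) (ap (Yp (\<epsilon> a)) w)" by (rule Y_commute)
    have "ap (Qp (\<rho> a * \<epsilon> b)) w = (if a = b then ap (Qp (\<rho> a)) w else 0)"
      using Q_eq[OF _ w, of "\<rho> a * \<epsilon> b" "if a = b then \<rho> a else 0"] ab by (auto simp: \<rho>_def \<epsilon>)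
    then show "ap (Xp (\<rho> a)) (ap (Yp (\<epsilon> b)) w)
        = ap (Yp (\<epsilon> b)) (ap (Xp (\<rho> a)) w) + (if a = b then ap (Qp (\<rho> a)) w else 0)"
      by (subst ap_lie_commute) (simp add: lie_X_Y)
    have "ap (Yp (\<kappa> * \<rho> a * \<epsilon> b)) w = ap (Yp (if a = b then smult (- 2) (\<epsilon> b) else 0)) w"
      using ab \<kappa> by (intro Y_eq w) (auto simp: \<rho>_def \<epsilon>)
    then show "ap (Qp (\<rho> a)) (ap (Yp (\<epsilon> b)) w)
        = ap (Yp (\<epsilon> b)) (ap (Qp (\<rho> a)) w) - (if a = b then 2 *f ap (Yp (\<epsilon> b)) w else 0)"
      by (subst ap_lie_commute) (simp add: lie_Q_Y poly_comb_smult poly_comb_minus)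
  qed (simp_all add: V J v X_v Qp_v pres_Yp Y_nilpotent)
  obtain as where as: "set as = J" "distinct as" using finite_distinct_list[OF J(1)] by blast
  have K: "sl.K = (\<Pi>\<^sub>E a\<in>J. {..sl.dd a})" by (rule sl.K_def)
  let ?F = "sl.M as"
  let ?U = "fs.span (?F ` sl.K)"
  have M_V: "?F g \<in> V" for g using sl.M_in_V as(1) by simp
  have U_V: "?U \<subseteq> V" using M_V by (intro fs.span_minimal V) blast
  have pres: "preserves ?U (y k)" for k
    unfolding preserves_def
  proof
    fix w assume w: "w \<in> ?U"
    then have "w \<in> V" using U_V by blast
    have "y k = Yp (monom 1 k)" by (simp add: poly_comb_monom)
    then have "ap (y k) w = ap (Yp (\<Sum>a\<in>J. smult (a ^ k) (\<epsilon> a))) w"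
      using Y_eq[OF _ \<open>w \<in> V\<close>, of "monom 1 k" "\<Sum>a\<in>J. smult (a ^ k) (\<epsilon> a)"] J(1)
      by (simp add: poly_monom poly_sum \<epsilon> if_distrib cong: if_cong sum.cong)
    also have "\<dots> = (\<Sum>a\<in>J. a ^ k *f ap (Yp (\<epsilon> a)) w)"
      by (simp add: poly_comb_sum poly_comb_smult ap_sum)
    also have "\<dots> \<in> ?U"
      using sl.f_span[OF as(2,1) _ w] by (intro fs.span_sum fs.span_scale)
    finally show "ap (y k) w \<in> ?U" .
  qed
  have "fs.span {v} \<subseteq> ?U"
    using sl.v_in_span[OF as(2,1)] by (intro fs.span_minimal) simp_all
  then have "V \<subseteq> ?U"
    using words_subset_subspace[OF _ pres] by (subst cyclic) (intro fs.span_minimal, simp_all)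
  then have span: "?U = V" using U_V by blast
  have weight: "ap A (sl.M bs g) = (\<theta> - 2 * of_nat (\<Sum>a\<in>set bs. g a)) *f sl.M bs g" if "distinct bs" for bs g
    using that
  proof (induction bs)
    case (Cons b bs)
    have "ap A (sl.M bs g) = (\<theta> - 2 * of_nat (\<Sum>a\<in>set bs. g a)) *f sl.M bs g" using Cons by simp
    from pow_weight[OF this] show ?case using Cons.prems by (simp add: algebra_simps)
  qed (simp add: A_v)
  show ?thesis
    using J(1) sl.M_inj[OF as(2,1)] sl.M_independent[OF as(2,1)] span weight[OF as(2)]
    unfolding K as(1)
    by (intro exI[of _ J] exI[of _ sl.dd] exI[of _ ?F]) simp
qed

end

section \<open>From matrices to operators on sequences\<close>

definition seq :: "'a::zero vec \<Rightarrow> nat \<Rightarrow> 'a" where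
  "seq v = (\<lambda>i. if i < dim_vec v then v $ i else 0)"

definition seqs :: "nat \<Rightarrow> (nat \<Rightarrow> 'a::zero) set" where
  "seqs n = {f. \<forall>i\<ge>n. f i = 0}"

lift_definition mat_lin :: "'a::field mat \<Rightarrow> 'a lin" is
  "\<lambda>M f i. if i < dim_row M then (\<Sum>j<dim_col M. M $$ (i, j) * f j) else 0"
  by (auto simp: fun_eq_iff pointwise algebra_simps sum.distrib sum_distrib_left)

lemma seq_in_seqs: "v \<in> carrier_vec n \<Longrightarrow> seq v \<in> seqs n"
  by (auto simp: seq_def seqs_def)

lemma seq_vec: "f \<in> seqs n \<Longrightarrow> seq (vec n f) = f"
  by (auto simp: seq_def seqs_def fun_eq_iff)

lemma vec_seq: "v \<in> carrier_vec n \<Longrightarrow> vec n (seq v) = v"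
  by (auto simp: seq_def)

lemma seq_inj: "inj_on seq (carrier_vec n)"
  by (rule inj_on_inverseI) (rule vec_seq)

lemma seqs_eq: "seqs n = seq ` carrier_vec n"
proof (intro equalityI subsetI)
  fix f :: "nat \<Rightarrow> 'a" assume "f \<in> seqs n"
  then have "f = seq (vec n f)" by (rule seq_vec[symmetric])
  then show "f \<in> seq ` carrier_vec n" by (rule image_eqI) simp
qed (use seq_in_seqs in blast)

lemma seq_add: "u \<in> carrier_vec n \<Longrightarrow> v \<in> carrier_vec n \<Longrightarrow> seq (u + v) = seq u + seq v"
  and seq_smult: "seq (c \<cdot>\<^sub>v u) = c *f seq u"
  and seq_zero: "seq (0\<^sub>v n) = 0"
  by (auto simp: seq_def fun_eq_iff pointwise)

lemma seq_eq_0_iff: "v \<in> carrier_vec n \<Longrightarrow> seq v = 0 \<longleftrightarrow> v = 0\<^sub>v n"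
  using inj_on_eq_iff[OF seq_inj[of n], of v "0\<^sub>v n"] by (simp add: seq_zero)

lemma ap_mat_lin_apply:
  "ap (mat_lin M) f i = (if i < dim_row M then (\<Sum>j<dim_col M. M $$ (i, j) * f j) else 0)"
  by (simp add: mat_lin.rep_eq)

lemma ap_mat_lin:
  assumes "M \<in> carrier_mat n n" "v \<in> carrier_vec n"
  shows "ap (mat_lin M) (seq v) = seq (M *\<^sub>v v)"
proof
  fix i
  have "(\<Sum>j<n. M $$ (i, j) * seq v j) = row M i \<bullet> v" if "i < n"
    unfolding scalar_prod_def using assms that by (intro sum.cong) (auto simp: seq_def)
  then show "ap (mat_lin M) (seq v) i = seq (M *\<^sub>v v) i"
    using assms by (simp add: ap_mat_lin_apply seq_def)
qed

lemma mat_lin_in_seqs: "M \<in> carrier_mat n n \<Longrightarrow> ap (mat_lin M) f \<in> seqs n"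
  by (simp add: seqs_def ap_mat_lin_apply)

lemma mat_lin_truncate:
  fixes M :: "'a::field mat"
  assumes "M \<in> carrier_mat n n"
  shows "mat_lin M * mat_lin (1\<^sub>m n) = mat_lin M"
proof (rule lin_eqI, rule ext)
  fix f :: "nat \<Rightarrow> 'a" and i
  have one: "ap (mat_lin (1\<^sub>m n)) f j = f j" if "j < n" for j
  proof -
    have "(\<Sum>k<n. 1\<^sub>m n $$ (j, k) * f k) = (\<Sum>k<n. if k = j then f j else 0)"
      using that by (intro sum.cong) auto
    then show ?thesis using that by (simp add: ap_mat_lin_apply)
  qed
  show "ap (mat_lin M * mat_lin (1\<^sub>m n)) f i = ap (mat_lin M) f i"
    unfolding ap_mult ap_mat_lin_apply[of M] using assms one by simp
qed

lemma subspace_seqs: "fs.subspace (seqs n :: (nat \<Rightarrow> 'a::field) set)"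
  by (auto simp: fs.subspace_def seqs_def pointwise)

lemma seqs_spanned: "\<exists>B. finite B \<and> (seqs n :: (nat \<Rightarrow> 'a::field) set) \<subseteq> fs.span B"
proof -
  let ?e = "\<lambda>k i. if i = k then 1 else 0 :: 'a"
  have "f \<in> fs.span (?e ` {..<n})" if "f \<in> seqs n" for f
  proof -
    have "f = (\<Sum>k<n. f k *f ?e k)"
    proof
      fix i
      have "(\<Sum>k<n. f k *f ?e k) i = (\<Sum>k<n. (f k *f ?e k) i)"
        by (rule sum_comp_morphism[symmetric, unfolded comp_def, of "\<lambda>g. g i"]) (simp_all add: pointwise)
      also have "\<dots> = (\<Sum>k<n. if k = i then f i else 0)"
        by (intro sum.cong) (simp_all add: pointwise)
      also have "\<dots> = f i" using that by (simp add: seqs_def)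
      finally show "f i = (\<Sum>k<n. f k *f ?e k) i" by simp
    qed
    moreover have "(\<Sum>k<n. f k *f ?e k) \<in> fs.span (?e ` {..<n})"
      by (intro fs.span_sum fs.span_scale fs.span_base imageI)
    ultimately show ?thesis by simp
  qed
  then show ?thesis by (intro exI[of _ "?e ` {..<n}"]) auto
qed

lemma eigspace_iff:
  assumes "M \<in> carrier_mat n n"
  shows "v \<in> eigspace M c \<longleftrightarrow> v \<in> carrier_vec n \<and> ap (mat_lin M) (seq v) = c *f seq v"
proof -
  have "v \<in> eigspace M c \<longleftrightarrow> v \<in> carrier_vec n \<and> (M - c \<cdot>\<^sub>m 1\<^sub>m n) *\<^sub>v v = 0\<^sub>v n"
    unfolding eigspace_def using assms by (subst mat_kernel[of _ n n]) auto
  also have "\<dots> \<longleftrightarrow> v \<in> carrier_vec n \<and> M *\<^sub>v v = c \<cdot>\<^sub>v v"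
  proof (rule conj_cong[OF refl])
    assume v: "v \<in> carrier_vec n"
    have "(c \<cdot>\<^sub>m 1\<^sub>m n) *\<^sub>v v = c \<cdot>\<^sub>v v"
      using v by (intro eq_vecI) (simp_all add: row_smult scalar_prod_left_unit)
    then have "(M - c \<cdot>\<^sub>m 1\<^sub>m n) *\<^sub>v v = M *\<^sub>v v - c \<cdot>\<^sub>v v"
      using assms v by (subst minus_mult_distrib_mat_vec[of _ n n]) simp_all
    then show "(M - c \<cdot>\<^sub>m 1\<^sub>m n) *\<^sub>v v = 0\<^sub>v n \<longleftrightarrow> M *\<^sub>v v = c \<cdot>\<^sub>v v"
      using assms v by (auto simp: vec_eq_iff)
  qed
  also have "\<dots> \<longleftrightarrow> v \<in> carrier_vec n \<and> seq (M *\<^sub>v v) = seq (c \<cdot>\<^sub>v v)"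
  proof (rule conj_cong[OF refl])
    assume v: "v \<in> carrier_vec n"
    then show "M *\<^sub>v v = c \<cdot>\<^sub>v v \<longleftrightarrow> seq (M *\<^sub>v v) = seq (c \<cdot>\<^sub>v v)"
      using assms by (intro inj_on_eq_iff[OF seq_inj[of n], symmetric]) auto
  qed
  finally show ?thesis using ap_mat_lin[OF assms] by (auto simp: seq_smult)
qed

definition eigs :: "nat \<Rightarrow> 'a::field mat \<Rightarrow> 'a \<Rightarrow> (nat \<Rightarrow> 'a) set" where
  "eigs n M c = {w \<in> seqs n. ap (mat_lin M) w = c *f w}"

lemma seq_eigspace: "M \<in> carrier_mat n n \<Longrightarrow> seq ` eigspace M c = eigs n M c"
  by (auto simp: eigs_def eigspace_iff seqs_eq)

lemma is_eigenvalue_iff: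
  assumes M: "M \<in> carrier_mat n n"
  shows "is_eigenvalue M c \<longleftrightarrow> (\<exists>w\<in>eigs n M c. w \<noteq> 0)"
proof -
  have "v \<noteq> 0\<^sub>v (dim_row M) \<longleftrightarrow> seq v \<noteq> 0" if "v \<in> eigspace M c" for v
    using that M eigspace_iff[OF M, of v c] seq_eq_0_iff[of v n] by simp
  then show ?thesis
    unfolding is_eigenvalue_def seq_eigspace[OF M, symmetric] by simp
qed

lemma kernel_dim_eigs:
  assumes M: "M \<in> carrier_mat n n"
  shows "kernel_dim (M - c \<cdot>\<^sub>m 1\<^sub>m (dim_row M)) = fs.dim (eigs n M c)"
proof -
  let ?N = "M - c \<cdot>\<^sub>m 1\<^sub>m n"
  have N: "?N \<in> carrier_mat n n" using M by auto
  interpret k: kernel n n ?N by standard (rule N)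
  obtain B where B: "finite B" "k.basis B" using kernel_basis_exists[OF N] by blast
  have B': "B \<subseteq> mat_kernel ?N" "k.span B = mat_kernel ?N" "k.lin_indpt B"
    using B(2) by (auto simp: k.Ker.basis_def)
  have ker: "mat_kernel ?N = eigspace M c" using M by (simp add: eigspace_def)
  have sub: "mat_kernel ?N \<subseteq> carrier_vec n" using mat_kernel_carrier[OF N] .
  have comb: "seq (k.lincomb a S) = (\<Sum>u\<in>S. a u *f seq u)" if "S \<subseteq> B" for a S
  proof
    fix i
    have S: "S \<subseteq> mat_kernel ?N" using that B'(1) by blast
    have dim: "k.lincomb a S \<in> carrier_vec n"
      using k.Ker.lincomb_closed[of S a] S sub by (auto simp: class_ring_simps)
    have "(\<Sum>u\<in>S. a u *f seq u) i = (\<Sum>u\<in>S. (a u *f seq u) i)"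
      by (rule sum_comp_morphism[symmetric, unfolded comp_def, of "\<lambda>g. g i"]) (simp_all add: pointwise)
    also have "\<dots> = (\<Sum>u\<in>S. if i < n then a u * u $ i else 0)"
      using S sub by (intro sum.cong) (auto simp: pointwise seq_def)
    also have "\<dots> = seq (k.lincomb a S) i"
      using k.lincomb_index[OF _ S, of i a] dim by (auto simp: seq_def)
    finally show "seq (k.lincomb a S) i = (\<Sum>u\<in>S. a u *f seq u) i" by simp
  qed
  have inj: "inj_on seq B" using inj_on_subset[OF seq_inj] B'(1) sub by blast
  have "fs.dim (eigs n M c) = card (seq ` B)"
  proof (rule fs.dim_unique[OF _ _ _ refl])
    show "seq ` B \<subseteq> eigs n M c"
      using B'(1) unfolding seq_eigspace[OF M, symmetric] ker by blast
    show "eigs n M c \<subseteq> fs.span (seq ` B)"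
    proof
      fix w assume "w \<in> eigs n M c"
      then have "w \<in> seq ` mat_kernel ?N" unfolding seq_eigspace[OF M, symmetric] ker .
      then obtain u where "u \<in> mat_kernel ?N" and u: "w = seq u" by blast
      then have "u \<in> k.span B" using B'(2) by simp
      then obtain a S where "S \<subseteq> B" "u = k.lincomb a S" unfolding k.Ker.span_def by blast
      then have "w = (\<Sum>u\<in>S. a u *f seq u)" using u comb by simp
      also have "\<dots> \<in> fs.span (seq ` B)"
        using \<open>S \<subseteq> B\<close> by (intro fs.span_sum fs.span_scale fs.span_base) blast
      finally show "w \<in> fs.span (seq ` B)" .
    qed
    show "fs.independent (seq ` B)"
    proof (rule fs.independent_if_scalars_zero)
      fix f w assume sum: "(\<Sum>x\<in>seq ` B. f x *f x) = 0" and w: "w \<in> seq ` B"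
      then obtain u where u: "u \<in> B" "w = seq u" by blast
      have "seq (k.lincomb (\<lambda>u. f (seq u)) B) = 0"
        using sum by (simp add: comb sum.reindex[OF inj])
      moreover have "k.lincomb (\<lambda>u. f (seq u)) B \<in> carrier_vec n"
        using k.Ker.lincomb_closed[of B "\<lambda>u. f (seq u)"] B'(1) sub by (auto simp: class_ring_simps)
      ultimately have "k.lincomb (\<lambda>u. f (seq u)) B = 0\<^sub>v n" using seq_eq_0_iff by blast
      then have "k.lin_dep B" if "f (seq u) \<noteq> 0"
        unfolding k.Ker.lin_dep_def using that B(1) u(1)
        by (intro exI[of _ B] exI[of _ "\<lambda>u. f (seq u)"] exI[of _ u]) (simp add: class_ring_simps)
      then show "f w = 0" using B'(3) u(2) by blast
    qed (use B(1) in simp)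
  qed
  also have "\<dots> = card B" by (rule card_image[OF inj])
  also have "\<dots> = k.dim" using k.Ker.dim_basis[OF B] by simp
  finally show ?thesis using M k.kernel_dim by simp
qed

section \<open>Tridiagonal pairs of Krawtchouk type\<close>

lemma dolan_grady_at_eigenvector:
  assumes w: "ap T w = c *f w" and S: "ap S w = b1 + b2 + b3"
    and b: "ap T b1 = (c + 2) *f b1" "ap T b2 = c *f b2" "ap T b3 = (c - 2) *f b3"
  shows "ap (lie T (lie T (lie T S))) w = ap (4 * lie T S) w"
proof -
  have step: "ap (lie T U) w = ap T (ap U w) - c *f ap U w" for U
    unfolding ap_lie w by simp
  have 1: "ap (lie T S) w = 2 *f b1 - 2 *f b3"
    unfolding step S ap_add_right b by (rule ext) (simp add: pointwise algebra_simps)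
  have 2: "ap (lie T (lie T S)) w = 4 *f b1 + 4 *f b3"
    unfolding step[of "lie T S"] 1 ap_diff_right ap_scale_right b
    by (rule ext) (simp add: pointwise algebra_simps)
  have 3: "ap (lie T (lie T (lie T S))) w = 8 *f b1 - 8 *f b3"
    unfolding step[of "lie T (lie T S)"] 2 ap_add_right ap_scale_right b
    by (rule ext) (simp add: pointwise algebra_simps)
  show ?thesis
    unfolding 3 ap_mult 1 ap_numeral by (rule ext) (simp add: pointwise algebra_simps)
qed

lemma diagonalizable_spanned:
  fixes M :: "'a::field mat"
  assumes M: "M \<in> carrier_mat n n" and "diagonalizable M"
  shows "seqs n \<subseteq> fs.span (\<Union>c. eigs n M c)"
proof
  fix w :: "nat \<Rightarrow> 'a" assume "w \<in> seqs n"
  then obtain v where v: "v \<in> carrier_vec n" "w = seq v" unfolding seqs_eq by blast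
  obtain D P Q where D: "diagonal_mat D" and sim: "similar_mat_wit M D P Q"
    using assms(2) unfolding diagonalizable_def similar_mat_def by blast
  have n: "dim_row M = n" using M by simp
  have car: "D \<in> carrier_mat n n" "P \<in> carrier_mat n n" "Q \<in> carrier_mat n n"
    and PQ: "P * Q = 1\<^sub>m n" "Q * P = 1\<^sub>m n" and MPDQ: "M = P * D * Q"
    using sim unfolding similar_mat_wit_def Let_def n by simp_all
  have "M * P = P * D * (Q * P)"
    unfolding MPDQ using car by (intro assoc_mult_mat[of _ n n _ n _ n]) simp_all
  then have MP: "M * P = P * D" using car by (simp add: PQ(2))
  have col: "seq (col P j) \<in> eigs n M (D $$ (j, j))" if j: "j < n" for j
  proof -
    have "(P * D) $$ (i, j) = D $$ (j, j) * P $$ (i, j)" if "i < n" for i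
    proof -
      have "(P * D) $$ (i, j) = (\<Sum>k = 0..<n. P $$ (i, k) * D $$ (k, j))"
        using car that j by (simp add: scalar_prod_def)
      also have "\<dots> = (\<Sum>k = 0..<n. if k = j then D $$ (j, j) * P $$ (i, j) else 0)"
        using D car j unfolding diagonal_mat_def by (intro sum.cong) auto
      finally show ?thesis using j by simp
    qed
    then have "col (P * D) j = D $$ (j, j) \<cdot>\<^sub>v col P j"
      using car j by (intro eq_vecI) simp_all
    then have "M *\<^sub>v col P j = D $$ (j, j) \<cdot>\<^sub>v col P j"
      using col_mult2[OF M car(2) j] MP by simp
    moreover have cP: "col P j \<in> carrier_vec n" using car(2) by auto
    ultimately show ?thesis
      using ap_mat_lin[OF M cP] seq_in_seqs[OF cP] by (simp add: eigs_def seq_smult)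
  qed
  have "v = P *\<^sub>v (Q *\<^sub>v v)"
    using assoc_mult_mat_vec[OF car(2,3) v(1)] PQ(1) v(1) by simp
  then have vi: "v $ i = (\<Sum>j<n. P $$ (i, j) * (Q *\<^sub>v v) $ j)" if "i < n" for i
  proof -
    have "(P *\<^sub>v (Q *\<^sub>v v)) $ i = (\<Sum>j<n. P $$ (i, j) * (Q *\<^sub>v v) $ j)"
      using car that by (simp add: scalar_prod_def lessThan_atLeast0)
    then show ?thesis using \<open>v = P *\<^sub>v (Q *\<^sub>v v)\<close> by simp
  qed
  have "w = (\<Sum>j<n. (Q *\<^sub>v v) $ j *f seq (col P j))"
  proof
    fix i
    have "(\<Sum>j<n. (Q *\<^sub>v v) $ j *f seq (col P j)) i = (\<Sum>j<n. ((Q *\<^sub>v v) $ j *f seq (col P j)) i)"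
      by (rule sum_comp_morphism[symmetric, unfolded comp_def, of "\<lambda>g. g i"]) (simp_all add: pointwise)
    also have "\<dots> = (\<Sum>j<n. if i < n then P $$ (i, j) * (Q *\<^sub>v v) $ j else 0)"
      using car by (intro sum.cong refl) (simp add: pointwise seq_def)
    also have "\<dots> = w i" using vi v by (simp add: seq_def)
    finally show "w i = (\<Sum>j<n. (Q *\<^sub>v v) $ j *f seq (col P j)) i" by simp
  qed
  also have "\<dots> \<in> fs.span (\<Union>c. eigs n M c)"
    using col by (intro fs.span_sum fs.span_scale fs.span_base) auto
  finally show "w \<in> fs.span (\<Union>c. eigs n M c)" .
qed

lemma length_krawtchouk_seq: "length (krawtchouk_seq d) = Suc d"
  by (simp add: krawtchouk_seq_def)

lemma krawtchouk_seq_nth: "i \<le> d \<Longrightarrow> krawtchouk_seq d ! i = of_int (int d - 2 * int i)"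
  by (simp add: krawtchouk_seq_def del: upt_Suc)

lemma eig_at_krawtchouk:
  assumes "M \<in> carrier_mat n n" "v \<in> eig_at M (krawtchouk_seq d) i"
  shows "v \<in> carrier_vec n \<and> ap (mat_lin M) (seq v) = of_int (int d - 2 * i) *f seq v"
proof (cases "0 \<le> i \<and> i < int (Suc d)")
  case True
  then have "v \<in> eigspace M (krawtchouk_seq d ! nat i)"
    using assms(2) by (simp add: eig_at_def length_krawtchouk_seq)
  moreover have "krawtchouk_seq d ! nat i = (of_int (int d - 2 * i) :: 'a)"
    using True by (subst krawtchouk_seq_nth) auto
  ultimately show ?thesis using eigspace_iff[OF assms(1)] by simp
next
  case False
  then have "v = 0\<^sub>v n" using assms by (auto simp: eig_at_def length_krawtchouk_seq)
  then show ?thesis by (simp add: seq_zero)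
qed

lemma krawtchouk_eigenvalues:
  fixes M :: "'a::field_char_0 mat"
  assumes M: "M \<in> carrier_mat n n" and st: "standard_ordering M Ms (krawtchouk_seq d)"
  shows "(\<exists>w\<in>eigs n M c. w \<noteq> 0) \<longleftrightarrow> (\<exists>i\<le>d. c = of_int (int d - 2 * int i))"
proof -
  have "(\<exists>w\<in>eigs n M c. w \<noteq> 0) \<longleftrightarrow> c \<in> set (krawtchouk_seq d)"
    using st is_eigenvalue_iff[OF M, of c] unfolding standard_ordering_def by simp
  also have "\<dots> \<longleftrightarrow> (\<exists>i\<le>d. c = of_int (int d - 2 * int i))"
    unfolding krawtchouk_seq_def by (auto simp: less_Suc_eq_le simp del: upt_Suc)
  finally show ?thesis .
qed

lemma krawtchouk_dolan_grady:
  fixes M Ms :: "'a::field_char_0 mat"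
  assumes M: "M \<in> carrier_mat n n" "Ms \<in> carrier_mat n n" and diag: "diagonalizable M"
    and st: "standard_ordering M Ms (krawtchouk_seq d)"
  defines "T \<equiv> mat_lin M" and "S \<equiv> mat_lin Ms"
  shows "lie T (lie T (lie T S)) = 4 * lie T S"
proof -
  let ?L = "lie T (lie T (lie T S))" and ?R = "4 * lie T S"
  have eig: "ap ?L w = ap ?R w" if w: "w \<in> eigs n M c" for w c
  proof (cases "w = 0")
    case False
    then obtain i where i: "i \<le> d" "c = of_int (int d - 2 * int i)"
      using krawtchouk_eigenvalues[OF M(1) st, of c] w by blast
    obtain v where v: "v \<in> eigspace M c" "w = seq v"
      using w unfolding seq_eigspace[OF M(1), symmetric] by blast
    then have vc: "v \<in> carrier_vec n" using eigspace_iff[OF M(1)] by blast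
    have "v \<in> eigspace M (krawtchouk_seq d ! i)" using v(1) i by (simp add: krawtchouk_seq_nth)
    moreover have "i < length (krawtchouk_seq d :: 'a list)" using i(1) by (simp add: length_krawtchouk_seq)
    ultimately have "Ms *\<^sub>v v \<in> sub_sum (sub_sum (eig_at M (krawtchouk_seq d) (int i - 1))
        (eig_at M (krawtchouk_seq d) (int i))) (eig_at M (krawtchouk_seq d) (int i + 1))"
      using st unfolding standard_ordering_def by blast
    then obtain u1 u2 u3 where u: "Ms *\<^sub>v v = u1 + u2 + u3" "u1 \<in> eig_at M (krawtchouk_seq d) (int i - 1)"
      "u2 \<in> eig_at M (krawtchouk_seq d) (int i)" "u3 \<in> eig_at M (krawtchouk_seq d) (int i + 1)"
      unfolding sub_sum_def by blast
    have weights: "of_int (int d - 2 * (int i - 1)) = c + 2" "of_int (int d - 2 * int i) = c"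
      "of_int (int d - 2 * (int i + 1)) = c - 2"
      by (simp_all add: i(2))
    note u' = u(2-4)[THEN eig_at_krawtchouk[OF M(1)]]
    show ?thesis
    proof (rule dolan_grady_at_eigenvector)
      show "ap T w = c *f w" using w by (simp add: eigs_def T_def)
      show "ap S w = seq u1 + seq u2 + seq u3"
        unfolding S_def v(2) ap_mat_lin[OF M(2) vc] u(1)
        using u' by (simp add: seq_add[of _ n])
      show "ap T (seq u1) = (c + 2) *f seq u1" "ap T (seq u2) = c *f seq u2" "ap T (seq u3) = (c - 2) *f seq u3"
        using u'[unfolded weights] by (simp_all add: T_def)
    qed
  qed simp
  have seqs: "ap ?L w = ap ?R w" if "w \<in> seqs n" for w
  proof -
    have "w \<in> fs.span (\<Union>c. eigs n M c)" using that diagonalizable_spanned[OF M(1) diag] by blast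
    then show ?thesis
    proof (induction rule: fs.span_induct_alt)
      case (step c x y)
      then have "ap ?L x = ap ?R x" using eig by blast
      then show ?case using step(2) by (simp only: ap_add_right ap_scale_right)
    qed simp
  qed
  let ?\<pi> = "mat_lin (1\<^sub>m n)"
  have T: "T * ?\<pi> = T" and S: "S * ?\<pi> = S"
    unfolding T_def S_def using M by (simp_all add: mat_lin_truncate)
  have lie: "lie T U * ?\<pi> = lie T U" if "U * ?\<pi> = U" for U
    by (simp add: lie_def left_diff_distrib mult.assoc T that)
  have tr: "?L * ?\<pi> = ?L" "?R * ?\<pi> = ?R"
    by (intro lie S, simp only: mult.assoc lie[OF S])
  show ?thesis
  proof (rule lin_eqI)
    fix f
    have "ap ?L (ap ?\<pi> f) = ap ?R (ap ?\<pi> f)" by (rule seqs) (rule mat_lin_in_seqs, simp)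
    then show "ap ?L f = ap ?R f" using tr by (metis ap_mult)
  qed
qed

lemma dim_weight_space:
  fixes \<theta> :: "'a::field_char_0"
  assumes K: "finite K" "inj_on F K" "fs.independent (F ` K)" "fs.span (F ` K) = V"
    and A: "\<And>g. g \<in> K \<Longrightarrow> ap A (F g) = (\<theta> - 2 * of_nat (s g)) *f F g"
  shows "fs.dim {w \<in> V. ap A w = (\<theta> - 2 * of_nat i) *f w} = card {g \<in> K. s g = (i::nat)}"
proof -
  let ?c = "\<theta> - 2 * of_nat i"
  let ?K = "{g \<in> K. s g = i}"
  have "fs.dim {w \<in> V. ap A w = ?c *f w} = card (F ` ?K)"
  proof (rule fs.dim_unique[OF _ _ _ refl])
    show "F ` ?K \<subseteq> {w \<in> V. ap A w = ?c *f w}"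
      using A K(4) fs.span_superset[of "F ` K"] by auto
    show "fs.independent (F ` ?K)"
      using K(3) by (rule fs.independent_mono) auto
    show "{w \<in> V. ap A w = ?c *f w} \<subseteq> fs.span (F ` ?K)"
    proof
      fix w assume "w \<in> {w \<in> V. ap A w = ?c *f w}"
      then have w: "w \<in> fs.span (F ` K)" "ap A w = ?c *f w" using K(4) by auto
      obtain u where u: "w = (\<Sum>e\<in>F ` K. u e *f e)"
        using w(1) fs.span_finite[of "F ` K"] K(1) by auto
      define w1 where "w1 = (\<Sum>g\<in>?K. u (F g) *f F g)"
      define w2 where "w2 = (\<Sum>g\<in>K - ?K. u (F g) *f F g)"
      have "w = (\<Sum>g\<in>K. u (F g) *f F g)" unfolding u sum.reindex[OF K(2)] comp_def ..
      also have "\<dots> = w2 + w1" unfolding w1_def w2_def by (rule sum.subset_diff) (use K(1) in auto)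
      finally have w12: "w = w2 + w1" .
      have "ap A w1 = ?c *f w1"
        unfolding w1_def ap_sum_right fs.scale_sum_right
      proof (intro sum.cong refl)
        fix g assume "g \<in> ?K"
        then have "ap A (F g) = ?c *f F g" using A by auto
        then show "ap A (u (F g) *f F g) = ?c *f (u (F g) *f F g)"
          by (simp add: fs.scale_left_commute mult.commute)
      qed
      then have A2: "ap A w2 = ?c *f w2" using w(2) unfolding w12 by (simp add: fs.scale_right_distrib)
      have "w2 = 0"
      proof (rule joint_eigenvectors_independent[where h = "\<lambda>_. A" and J = "{()}" and \<theta> = "\<lambda>_. ?c" and E = "F ` (K - ?K)"])
        show "w2 \<in> fs.span (F ` (K - ?K))"
          unfolding w2_def by (intro fs.span_sum fs.span_scale fs.span_base imageI)
        fix e assume "e \<in> F ` (K - ?K)"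
        then obtain g where g: "g \<in> K" "s g \<noteq> i" "e = F g" by blast
        then have e: "ap A e = (\<theta> - 2 * of_nat (s g)) *f e" using A by simp
        then show "\<exists>c. ap A e = c *f e" for j :: unit by blast
        show "\<exists>j\<in>{()}. \<exists>c. ap A e = c *f e \<and> c \<noteq> ?c"
          using e g(2) by (intro bexI[of _ "()"] exI[of _ "\<theta> - 2 * of_nat (s g)"]) simp_all
      qed (rule A2)
      then have "w = w1" using w12 by simp
      then show "w \<in> fs.span (F ` ?K)"
        unfolding w1_def by (simp only:) (intro fs.span_sum fs.span_scale fs.span_base imageI)
    qed
  qed
  also have "\<dots> = card ?K" using K(2) by (intro card_image) (auto simp: inj_on_def)
  finally show ?thesis .
qed

lemma prod_truncated_geometric:
  fixes J :: "'i set" and dd :: "'i \<Rightarrow> nat"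
  defines "K \<equiv> \<Pi>\<^sub>E a\<in>J. {..dd a}"
  assumes J: "finite J" and bound: "\<And>g. g \<in> K \<Longrightarrow> (\<Sum>a\<in>J. g a) \<le> d"
  shows "(\<Sum>i\<le>d. monom (int (card {g \<in> K. (\<Sum>a\<in>J. g a) = i})) i) = (\<Prod>a\<in>J. \<Sum>k\<le>dd a. monom (1::int) k)"
proof -
  have fin: "finite K" unfolding K_def using J by (intro finite_PiE) auto
  have prod: "(\<Prod>a\<in>J. monom (1::int) (g a)) = monom 1 (\<Sum>a\<in>J. g a)" for g :: "'i \<Rightarrow> nat"
    using J by (induction J rule: finite_induct) (simp_all add: mult_monom)
  have "(\<Prod>a\<in>J. \<Sum>k\<le>dd a. monom (1::int) k) = (\<Sum>g\<in>K. \<Prod>a\<in>J. monom 1 (g a))"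
    unfolding K_def by (rule prod_sum_PiE) (use J in auto)
  also have "\<dots> = (\<Sum>g\<in>K. monom 1 (\<Sum>a\<in>J. g a))" unfolding prod ..
  also have "\<dots> = (\<Sum>i\<le>d. \<Sum>g\<in>{g \<in> K. (\<Sum>a\<in>J. g a) = i}. monom 1 (\<Sum>a\<in>J. g a))"
    by (rule sum.group[symmetric]) (use fin bound in auto)
  also have "\<dots> = (\<Sum>i\<le>d. monom (int (card {g \<in> K. (\<Sum>a\<in>J. g a) = i})) i)"
    by (intro sum.cong refl) (simp add: of_nat_poly mult_monom flip: monom_0)
  finally show ?thesis by simp
qed

lemma krawtchouk_weight_basis:
  fixes A As :: "'a::field_char_0 mat"
  assumes closed: "alg_closed_field TYPE('a)" and TD: "TD_pair n A As" and kr: "krawtchouk_type A As d"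
  shows "\<exists>(J :: 'a set) dd F. finite J \<and> inj_on F (\<Pi>\<^sub>E a\<in>J. {..dd a}) \<and>
    fs.independent (F ` (\<Pi>\<^sub>E a\<in>J. {..dd a :: nat})) \<and> fs.span (F ` (\<Pi>\<^sub>E a\<in>J. {..dd a})) = seqs n \<and>
    (\<forall>g \<in> \<Pi>\<^sub>E a\<in>J. {..dd a}.
      ap (mat_lin A) (F g) = (of_nat d - 2 * of_nat (\<Sum>a\<in>J. g a)) *f F g)"
proof -
  have car: "A \<in> carrier_mat n n" "As \<in> carrier_mat n n"
    and diag: "diagonalizable A" "diagonalizable As"
    and irr: "\<And>W. is_subspace n W \<Longrightarrow> (\<forall>w\<in>W. A *\<^sub>v w \<in> W) \<Longrightarrow> (\<forall>w\<in>W. As *\<^sub>v w \<in> W)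
      \<Longrightarrow> W = {0\<^sub>v n} \<or> W = carrier_vec n"
    using TD unfolding TD_pair_def by blast+
  have st: "standard_ordering A As (krawtchouk_seq d)" "standard_ordering As A (krawtchouk_seq d)"
    using kr unfolding krawtchouk_type_def by blast+
  define T where "T = mat_lin A"
  define S where "S = mat_lin As"
  define L1 where "L1 = lie T S"
  define L2 where "L2 = lie T L1"
  define X where "X = sc (1/8) * (L2 + 2 * L1)"
  define Y where "Y = sc (1/8) * (L2 - 2 * L1)"
  define Z where "Z = S - sc (1/4) * L2"
  have L3: "lie T L2 = 4 * L1"
    unfolding L2_def L1_def T_def S_def by (rule krawtchouk_dolan_grady[OF car diag(1) st(1)])
  have DG: "lie S (lie S (lie S T)) = 4 * lie S T"
    unfolding T_def S_def by (rule krawtchouk_dolan_grady[OF car(2,1) diag(2) st(2)])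
  have T_X: "lie T X = 2 * X" and T_Y: "lie T Y = - (2 * Y)" and T_Z: "lie T Z = 0" and XYZ: "X + Y + Z = S"
    unfolding X_def Y_def Z_def
    by (simp_all add: L3 L1_def[symmetric] L2_def[symmetric])
      (rule lin_eqI, rule ext, simp add: pointwise field_simps)+
  note rel = dolan_grady_weight_components[OF lin_torsion_free T_X T_Y T_Z, unfolded XYZ, OF _ DG]
  interpret o: onsager X Y Z
    by (standard, erule lin_torsion_free) (rule rel, assumption)+
  have T_x: "lie T (o.x k) = 2 * o.x k" for k
  proof (induction k)
    case (Suc k)
    then show ?case by (simp add: o.lie_Z_x[symmetric] lie_jacobi[of T Z] T_Z)
  qed (simp add: T_X)
  have T_y: "lie T (o.y k) = - (2 * o.y k)" for k
  proof (induction k)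
    case (Suc k)
    have "o.y (Suc k) = - lie Z (o.y k)" by (simp add: o.lie_Z_y)
    then show ?case using Suc by (simp add: lie_jacobi[of T Z] T_Z)
  qed (simp add: T_Y)
  have T_Q: "lie T (o.Q k) = 0" for k
    unfolding o.Q_def by (simp add: lie_jacobi[of T] T_x T_Y)
  let ?V = "seqs n :: (nat \<Rightarrow> 'a) set"
  note V = subspace_seqs[of n, where 'a = 'a]
  obtain B where B: "finite B" "?V \<subseteq> fs.span B" using seqs_spanned by blast
  have pT: "preserves ?V T" and pS: "preserves ?V S"
    using mat_lin_in_seqs[OF car(1)] mat_lin_in_seqs[OF car(2)] by (simp_all add: preserves_def T_def S_def)
  have p2: "preserves ?V (2 :: 'a lin)"
    by (simp add: preserves_def fs.subspace_scale[OF V])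
  have pL: "preserves ?V L1" "preserves ?V L2"
    unfolding L2_def L1_def by (intro preserves_lie[OF V] pT pS)+
  have pX: "preserves ?V X" and pY: "preserves ?V Y" and pZ: "preserves ?V Z"
    unfolding X_def Y_def Z_def
    by (intro preserves_add[OF V] preserves_diff[OF V] preserves_mult[OF V] preserves_sc[OF V] pL pS p2)+
  have px: "preserves ?V (o.x k)" for k
    by (induction k) (simp_all add: pX preserves_lie[OF V] pZ o.lie_Z_x[symmetric])
  have py: "preserves ?V (o.y k)" for k
  proof (induction k)
    case (Suc k)
    have "o.y (Suc k) = - lie Z (o.y k)" by (simp add: o.lie_Z_y)
    then show ?case using Suc by (simp add: preserves_minus[OF V] preserves_lie[OF V] pZ)
  qed (simp add: pY)
  have pQ: "preserves ?V (o.Q k)" for k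
    unfolding o.Q_def by (intro preserves_lie[OF V] px pY)
  have no_eig: "w = 0" if "w \<in> ?V" "ap T w = of_int (int d - 2 * j) *f w" "j < 0 \<or> j > int d" for w j
  proof (rule ccontr)
    assume "w \<noteq> 0"
    then have "\<exists>w\<in>eigs n A (of_int (int d - 2 * j)). w \<noteq> 0"
      using that by (auto simp: eigs_def T_def)
    then obtain i where "i \<le> d" "(of_int (int d - 2 * j) :: 'a) = of_int (int d - 2 * int i)"
      using krawtchouk_eigenvalues[OF car(1) st(1)] by blast
    then show False using that(3) unfolding of_int_eq_iff by linarith
  qed
  interpret hw: highest_weight ?V B T Z o.x o.y o.Q "of_nat d"
  proof
    show "lie T (o.y k) = sc (- 2) * o.y k" for k
      by (rule lin_eqI) (simp add: T_y)
    show "lie (o.Q i) (o.y j) = sc (1/2) * o.y (i + j + 2) + sc (- 2) * o.y (i + j)" for i j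
    proof -
      have "lie (o.Q i) (o.y j) = sc (1/2) * (2 * lie (o.Q i) (o.y j))"
        by (rule lin_eqI) simp
      also have "\<dots> = sc (1/2) * o.y (i + j + 2) + sc (- 2) * o.y (i + j)"
        unfolding o.two_lie_Q_y by (rule lin_eqI, rule ext) (simp add: pointwise algebra_simps)
      finally show ?thesis .
    qed
    show "ap (o.x k) w = 0" if "w \<in> ?V" "ap T w = of_nat d *f w" for w k
    proof (rule no_eig[where j = "- 1"])
      show "ap (o.x k) w \<in> ?V" by (rule preservesD[OF px that(1)])
      show "ap T (ap (o.x k) w) = of_int (int d - 2 * - 1) *f ap (o.x k) w"
        by (subst ap_lie_commute) (simp add: T_x that(2) fs.scale_left_distrib)
    qed simp
    show "\<exists>w\<in>?V. w \<noteq> 0 \<and> ap T w = of_nat d *f w"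
    proof -
      have "\<exists>w\<in>eigs n A (of_int (int d - 2 * int 0)). w \<noteq> 0"
        unfolding krawtchouk_eigenvalues[OF car(1) st(1)] by (intro exI[of _ 0]) simp
      then show ?thesis by (auto simp: eigs_def T_def)
    qed
    show "\<exists>N. \<forall>w\<in>?V. ap T w = (of_nat d - 2 * of_nat N) *f w \<longrightarrow> w = 0"
    proof (intro exI[of _ "Suc d"] ballI impI)
      fix w assume "w \<in> ?V" "ap T w = (of_nat d - 2 * of_nat (Suc d)) *f w"
      then show "w = 0" by (intro no_eig[of w "int (Suc d)"]) simp_all
    qed
    fix W :: "(nat \<Rightarrow> 'a) set"
    assume W: "fs.subspace W" "W \<subseteq> ?V" and inv: "preserves W T" "preserves W Z" "preserves W (o.x 0)" "preserves W (o.y 0)"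
    have "preserves W (X + Y + Z)" using inv by (intro preserves_add[OF W(1)]) simp_all
    then have invS: "preserves W S" unfolding XYZ .
    let ?W = "{v \<in> carrier_vec n. seq v \<in> W}"
    have WV: "W = seq ` ?W" using W(2) unfolding seqs_eq by blast
    have "is_subspace n ?W"
      unfolding is_subspace_def
      by (auto simp: seq_zero seq_add[of _ n] seq_smult fs.subspace_0[OF W(1)] fs.subspace_add[OF W(1)]
          fs.subspace_scale[OF W(1)])
    moreover have "\<forall>w\<in>?W. M *\<^sub>v w \<in> ?W" if M: "M \<in> carrier_mat n n" "preserves W (mat_lin M)" for M
    proof
      fix w assume w: "w \<in> ?W"
      have "seq (M *\<^sub>v w) \<in> W"
        using preservesD[OF M(2), of "seq w"] ap_mat_lin[OF M(1), of w] w by simp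
      then show "M *\<^sub>v w \<in> ?W" using M(1) w by auto
    qed
    ultimately have "?W = {0\<^sub>v n} \<or> ?W = carrier_vec n"
      using inv(1) invS car unfolding T_def S_def by (intro irr)
    then show "W = {0} \<or> W = ?V"
    proof
      assume "?W = {0\<^sub>v n}"
      then have "W = {0}" by (subst WV) (simp add: seq_zero)
      then show ?thesis ..
    next
      assume "?W = carrier_vec n"
      then have "W = ?V" unfolding seqs_eq by (subst WV) simp
      then show ?thesis ..
    qed
  qed (fact closed V B pT pZ px py pQ T_Z T_Q o.lie_x_y o.lie_y_y o.lie_Z_y o.lie_Z_Q o.lie_Q_Q)+
  obtain v lam z where v: "v \<in> ?V" "v \<noteq> 0" "ap T v = of_nat d *f v" "ap Z v = z *f v" "\<forall>k. ap (o.Q k) v = lam k *f v"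
    using hw.top_vector by (elim exE conjE)
  interpret hv: highest_weight_vector ?V B T Z o.x o.y o.Q "of_nat d" v lam z
    by standard (rule v(1) v(2) v(3) v(4) v(5)[rule_format])+
  show ?thesis using hv.weight_basis unfolding T_def .
qed

theorem theorem8p3:
  fixes A As :: "'a::field_char_0 mat" and n d :: nat
  assumes "alg_closed_field TYPE('a)"
    and "TD_pair n A As"
    and "krawtchouk_type A As d"
  shows "(\<exists>ds :: nat list. (\<forall>dj \<in> set ds. dj > 0) \<and>
           (\<Sum>i\<le>d. monom (int (shape A d ! i)) i)
             = (\<Prod>dj\<leftarrow>ds. \<Sum>k\<le>dj. monom (1::int) k)) \<and>
         shape A d ! 0 = 1"
proof -
  obtain J :: "'a set" and dd F where J: "finite J" and inj: "inj_on F (\<Pi>\<^sub>E a\<in>J. {..dd a})"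
    and ind: "fs.independent (F ` (\<Pi>\<^sub>E a\<in>J. {..dd a :: nat}))"
    and span: "fs.span (F ` (\<Pi>\<^sub>E a\<in>J. {..dd a})) = seqs n"
    and weight: "\<And>g. g \<in> (\<Pi>\<^sub>E a\<in>J. {..dd a}) \<Longrightarrow>
      ap (mat_lin A) (F g) = (of_nat d - 2 * of_nat (\<Sum>a\<in>J. g a)) *f F g"
    using krawtchouk_weight_basis[OF assms] by blast
  define K where "K = (\<Pi>\<^sub>E a\<in>J. {..dd a})"
  note inj = inj[folded K_def] and ind = ind[folded K_def] and span = span[folded K_def]
    and weight = weight[folded K_def]
  have fin: "finite K" unfolding K_def using J by (intro finite_PiE) auto
  have A: "A \<in> carrier_mat n n" and st: "standard_ordering A As (krawtchouk_seq d)"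
    using assms(2,3) by (auto simp: TD_pair_def krawtchouk_type_def)
  have eigs: "eigs n A (of_int (int d - 2 * int i)) = {w \<in> seqs n. ap (mat_lin A) w = (of_nat d - 2 * of_nat i) *f w}" for i
    by (simp add: eigs_def)
  have shape: "shape A d ! i = card {g \<in> K. (\<Sum>a\<in>J. g a) = i}" if "i \<le> d" for i
  proof -
    have "shape A d ! i = kernel_dim (A - krawtchouk_seq d ! i \<cdot>\<^sub>m 1\<^sub>m (dim_row A))"
      unfolding shape_def using that by (intro nth_map) (simp add: length_krawtchouk_seq)
    also have "\<dots> = fs.dim (eigs n A (of_int (int d - 2 * int i)))"
      unfolding kernel_dim_eigs[OF A] krawtchouk_seq_nth[OF that] ..
    also have "\<dots> = card {g \<in> K. (\<Sum>a\<in>J. g a) = i}"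
      unfolding eigs by (rule dim_weight_space[OF fin inj ind span weight])
    finally show ?thesis .
  qed
  have bound: "(\<Sum>a\<in>J. g a) \<le> d" if g: "g \<in> K" for g
  proof -
    have "F g \<in> seqs n" unfolding span[symmetric] using g by (intro fs.span_base imageI)
    then have "F g \<in> eigs n A (of_int (int d - 2 * int (\<Sum>a\<in>J. g a)))"
      unfolding eigs using weight[OF g] by simp
    moreover have "F g \<noteq> 0"
    proof
      assume "F g = 0"
      then have "0 \<in> F ` K" using g by (metis imageI)
      then have "fs.dependent (F ` K)" by (rule fs.dependent_zero)
      then show False using ind by simp
    qed
    ultimately obtain i where "i \<le> d" "(of_int (int d - 2 * int (\<Sum>a\<in>J. g a)) :: 'a) = of_int (int d - 2 * int i)"
      using krawtchouk_eigenvalues[OF A st] by blast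
    then show ?thesis unfolding of_int_eq_iff by linarith
  qed
  obtain as where as: "set as = J" "distinct as" using finite_distinct_list[OF J] by blast
  define ds where "ds = map dd (filter (\<lambda>a. dd a > 0) as)"
  have "(\<Prod>dj\<leftarrow>ds. \<Sum>k\<le>dj. monom (1::int) k)
      = (\<Prod>a\<leftarrow>filter (\<lambda>a. dd a > 0) as. \<Sum>k\<le>dd a. monom (1::int) k)"
    by (simp add: ds_def comp_def)
  also have "\<dots> = (\<Prod>a\<in>set (filter (\<lambda>a. dd a > 0) as). \<Sum>k\<le>dd a. monom (1::int) k)"
    by (rule prod.distinct_set_conv_list[symmetric]) (use as in simp)
  also have "set (filter (\<lambda>a. dd a > 0) as) = {a \<in> J. dd a > 0}"
    by (simp add: as(1))
  also have "(\<Prod>a\<in>{a \<in> J. dd a > 0}. \<Sum>k\<le>dd a. monom (1::int) k) = (\<Prod>a\<in>J. \<Sum>k\<le>dd a. monom (1::int) k)"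
    using J by (intro prod.mono_neutral_left) auto
  also have "\<dots> = (\<Sum>i\<le>d. monom (int (card {g \<in> K. (\<Sum>a\<in>J. g a) = i})) i)"
    using prod_truncated_geometric[OF J, of dd d] bound unfolding K_def by simp
  also have "\<dots> = (\<Sum>i\<le>d. monom (int (shape A d ! i)) i)"
    by (intro sum.cong refl) (simp add: shape)
  finally have prod: "(\<Sum>i\<le>d. monom (int (shape A d ! i)) i) = (\<Prod>dj\<leftarrow>ds. \<Sum>k\<le>dj. monom (1::int) k)" ..
  have "{g \<in> K. (\<Sum>a\<in>J. g a) = 0} = {restrict (\<lambda>_. 0) J}"
  proof (intro equalityI subsetI)
    fix g assume "g \<in> {g \<in> K. (\<Sum>a\<in>J. g a) = 0}"
    then have "g \<in> extensional J" "\<And>a. a \<in> J \<Longrightarrow> g a = 0" using J by (auto simp: K_def PiE_def)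
    then show "g \<in> {restrict (\<lambda>_. 0) J}" by (auto intro: extensionalityI)
  next
    fix g assume "g \<in> {restrict (\<lambda>_. 0 :: nat) J}"
    then show "g \<in> {g \<in> K. (\<Sum>a\<in>J. g a) = 0}" by (simp add: K_def)
  qed
  then have "shape A d ! 0 = 1" by (simp add: shape)
  moreover have "\<forall>dj\<in>set ds. dj > 0" by (auto simp: ds_def)
  ultimately show ?thesis using prod by blast
qed

end
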